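(* Let $G$ be a finite non-empty graph and let $k$ be a non-negative integer. Then $G$ has ab-tree-cut width $\leq k$ if and only if $G$ is $k$-searchable.
   Context: Graphs are finite and undirected; parallel edges are allowed, loops are not. A near-partition of a set $\Omega$ is a family of pairwise disjoint (possibly empty) subsets of $\Omega$ with union $\Omega$. Two vertices $u,v$ of $G$ are 3-edge-connected in $G$ if $u=v$ or there are three pairwise edge-disjoint paths in $G$ connecting $u$ and $v$. ab-tree-cut width. A tree-cut decomposition of $G$ is a pair $\mathcal{T}=(T,\mathcal{X})$ where $T$ is a tree and $\mathcal{X}=\{X_t : t\in V(T)\}$ is a near-partition of $V(G)$ indexed by the nodes of $T$; $X_t$ is the bag of $t$. For an edge $st$ of $T$, $\mathrm{adh}(st)$ is the set of edges $uv$ of $G$ such that the node whose bag contains $u$ and the node whose bag contains $v$ lie in different components of $T-st$. The edge $st$ is bold if $|\mathrm{adh}(st)|\geq 3$ and thin otherwise. For a node $t$, $\mathrm{adh}(t)$ is the union of the sets $\mathrm{adh}(st)$ over all bold edges $st$ of $T$ incident to $t$. The adhesion-width of $\mathcal{T}$ is $\max_{t\in V(T)}|\mathrm{adh}(t)|$ and the bag-width of $\mathcal{T}$ is $\max_{t\in V(T)}|X_t|$. The ab-tree-cut width of $G$ is the least number $k$ such that $G$ has a tree-cut decomposition with adhesion-width $\leq k$ and bag-width $\leq k$. The cops, dogs, and robber game with $p$ cops and $q$ dogs ($p,q\geq 0$ integers) is played on $G$ by two players, the cop player (controlling cops and dogs) and the robber player. The robber player first places the robber at a vertex $r_0$; the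 cops initially occupy the edge set $F_0=\emptyset$. In each round $i=1,2,3,\ldots$: the cop player announces a set $F_i\subseteq E(G)$ with $|F_i|\leq p$; then the robber player, knowing $F_i$, moves the robber from $r_{i-1}$ to a vertex $r_i$ (possibly $r_i=r_{i-1}$) that is reachable from $r_{i-1}$ by a path of $G$ containing no edge of $F_{i-1}\cap F_i$ and that is 3-edge-connected with $r_{i-1}$ in $G$; then the cops move to $F_i$. After each round $i$, if the number of vertices of $G$ that are 3-edge-connected with $r_i$ in $G$ and reachable from $r_i$ by a path avoiding the edges of $F_i$ (including $r_i$ itself) is $\leq q$, the cop player wins immediately. The robber player wins if she avoids being caught indefinitely. $G$ is searchable by $p$ cops and $q$ dogs if the cop player has a strategy to win this game, and $k$-searchable if it is searchable by $k$ cops and $k$ dogs. *)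

theory Defs
  imports Main "HOL-Library.Disjoint_Sets"
begin

record ('v, 'e) multigraph =
  verts :: "'v set"
  edges :: "'e set"
  ends :: "'e \<Rightarrow> 'v set"

text \<open>Edges have their own identity, so distinct edges may have the same pair of ends;
  requiring exactly two ends excludes loops.\<close>

definition fin_multigraph :: "('v, 'e) multigraph \<Rightarrow> bool" where
  "fin_multigraph G \<longleftrightarrow> finite (verts G) \<and> finite (edges G) \<and>
     (\<forall>e\<in>edges G. ends G e \<subseteq> verts G \<and> card (ends G e) = 2)"

text \<open>A walk starting at \<open>u\<close> is recorded as the list of its steps \<open>(e, w)\<close>:
  traverse the edge \<open>e\<close> and arrive at \<open>w\<close>.\<close>

fun walk :: "('v, 'e) multigraph \<Rightarrow> 'v \<Rightarrow> ('e \<times> 'v) list \<Rightarrow> 'v \<Rightarrow> bool" where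
  "walk G u [] v \<longleftrightarrow> u = v \<and> u \<in> verts G"
| "walk G u ((e, w) # p) v \<longleftrightarrow> e \<in> edges G \<and> ends G e = {u, w} \<and> walk G w p v"

definition walk_edges :: "('e \<times> 'v) list \<Rightarrow> 'e set" where
  "walk_edges p = set (map fst p)"

definition path :: "('v, 'e) multigraph \<Rightarrow> 'v \<Rightarrow> ('e \<times> 'v) list \<Rightarrow> 'v \<Rightarrow> bool" where
  "path G u p v \<longleftrightarrow> walk G u p v \<and> distinct (u # map snd p)"

text \<open>Two parallel edges form a cycle; a single edge traversed back and forth does not.\<close>

definition cycle :: "('v, 'e) multigraph \<Rightarrow> 'v \<Rightarrow> ('e \<times> 'v) list \<Rightarrow> bool" where
  "cycle G u p \<longleftrightarrow>
     p \<noteq> [] \<and> walk G u p u \<and> distinct (map snd p) \<and> distinct (map fst p)"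

definition reachable_avoiding ::
    "('v, 'e) multigraph \<Rightarrow> 'e set \<Rightarrow> 'v \<Rightarrow> 'v \<Rightarrow> bool" where
  "reachable_avoiding G F u v \<longleftrightarrow> (\<exists>p. path G u p v \<and> walk_edges p \<inter> F = {})"

definition three_edge_connected :: "('v, 'e) multigraph \<Rightarrow> 'v \<Rightarrow> 'v \<Rightarrow> bool" where
  "three_edge_connected G u v \<longleftrightarrow> u = v \<or>
     (\<exists>p1 p2 p3. path G u p1 v \<and> path G u p2 v \<and> path G u p3 v \<and>
        walk_edges p1 \<inter> walk_edges p2 = {} \<and>
        walk_edges p1 \<inter> walk_edges p3 = {} \<and>
        walk_edges p2 \<inter> walk_edges p3 = {})"

definition tree :: "('t, 'f) multigraph \<Rightarrow> bool" where
  "tree T \<longleftrightarrow> fin_multigraph T \<and> verts T \<noteq> {} \<and>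
     (\<forall>s\<in>verts T. \<forall>t\<in>verts T. \<exists>p. path T s p t) \<and>
     (\<nexists>t p. cycle T t p)"


subsection \<open>ab-tree-cut width\<close>

definition near_partition_on :: "'v set \<Rightarrow> 't set \<Rightarrow> ('t \<Rightarrow> 'v set) \<Rightarrow> bool" where
  "near_partition_on \<Omega> I X \<longleftrightarrow> disjoint_family_on X I \<and> (\<Union>t\<in>I. X t) = \<Omega>"

definition tree_cut_decomposition ::
    "('v, 'e) multigraph \<Rightarrow> ('t, 'f) multigraph \<Rightarrow> ('t \<Rightarrow> 'v set) \<Rightarrow> bool" where
  "tree_cut_decomposition G T X \<longleftrightarrow> tree T \<and> near_partition_on (verts G) (verts T) X"

text \<open>Two nodes lie in different components of the forest obtained from \<open>T\<close> by deleting
  the edge \<open>f\<close> iff no path of \<open>T\<close> avoiding \<open>f\<close> joins them.\<close>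

definition edge_adh ::
    "('v, 'e) multigraph \<Rightarrow> ('t, 'f) multigraph \<Rightarrow> ('t \<Rightarrow> 'v set) \<Rightarrow> 'f \<Rightarrow> 'e set" where
  "edge_adh G T X f = {e \<in> edges G. \<exists>u v. ends G e = {u, v} \<and>
     (\<exists>s\<in>verts T. \<exists>t\<in>verts T. u \<in> X s \<and> v \<in> X t \<and> \<not> reachable_avoiding T {f} s t)}"

definition bold ::
    "('v, 'e) multigraph \<Rightarrow> ('t, 'f) multigraph \<Rightarrow> ('t \<Rightarrow> 'v set) \<Rightarrow> 'f \<Rightarrow> bool" where
  "bold G T X f \<longleftrightarrow> card (edge_adh G T X f) \<ge> 3"

definition node_adh ::
    "('v, 'e) multigraph \<Rightarrow> ('t, 'f) multigraph \<Rightarrow> ('t \<Rightarrow> 'v set) \<Rightarrow> 't \<Rightarrow> 'e set" where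
  "node_adh G T X t = (\<Union>f\<in>{f \<in> edges T. t \<in> ends T f \<and> bold G T X f}. edge_adh G T X f)"

definition adhesion_width ::
    "('v, 'e) multigraph \<Rightarrow> ('t, 'f) multigraph \<Rightarrow> ('t \<Rightarrow> 'v set) \<Rightarrow> nat" where
  "adhesion_width G T X = Max ((\<lambda>t. card (node_adh G T X t)) ` verts T)"

definition bag_width :: "('t, 'f) multigraph \<Rightarrow> ('t \<Rightarrow> 'v set) \<Rightarrow> nat" where
  "bag_width T X = Max ((\<lambda>t. card (X t)) ` verts T)"

text \<open>Trees are finite, so up to isomorphism their nodes and edges are natural numbers.
  The tree with a single node always gives a decomposition of finite width,
  so the minimum is attained.\<close>

definition ab_tree_cut_width :: "('v, 'e) multigraph \<Rightarrow> nat" where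
  "ab_tree_cut_width G = (LEAST k. \<exists>(T :: (nat, nat) multigraph) X.
     tree_cut_decomposition G T X \<and> adhesion_width G T X \<le> k \<and> bag_width T X \<le> k)"


subsection \<open>Cops, dogs, and robber\<close>

definition robber_move ::
    "('v, 'e) multigraph \<Rightarrow> 'e set \<Rightarrow> 'e set \<Rightarrow> 'v \<Rightarrow> 'v \<Rightarrow> bool" where
  "robber_move G F F' r r' \<longleftrightarrow>
     reachable_avoiding G (F \<inter> F') r r' \<and> three_edge_connected G r r'"

definition caught :: "('v, 'e) multigraph \<Rightarrow> nat \<Rightarrow> 'e set \<Rightarrow> 'v \<Rightarrow> bool" where
  "caught G q F r \<longleftrightarrow>
     card {v \<in> verts G. three_edge_connected G r v \<and> reachable_avoiding G F r v} \<le> q"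

text \<open>Both players have perfect information. A strategy of the cop player maps the list
  \<open>[r 0, \<dots>, r (i - 1)]\<close> of the robber's positions so far to the set announced in round \<open>i\<close>;
  the earlier moves of the cops are determined by the strategy and this list.\<close>

type_synonym ('v, 'e) cop_strategy = "'v list \<Rightarrow> 'e set"

definition cop_strategy :: "('v, 'e) multigraph \<Rightarrow> nat \<Rightarrow> ('v, 'e) cop_strategy \<Rightarrow> bool" where
  "cop_strategy G p \<sigma> \<longleftrightarrow> (\<forall>h. \<sigma> h \<subseteq> edges G \<and> card (\<sigma> h) \<le> p)"

definition cops_at :: "('v, 'e) cop_strategy \<Rightarrow> (nat \<Rightarrow> 'v) \<Rightarrow> nat \<Rightarrow> 'e set" where
  "cops_at \<sigma> r i = (if i = 0 then {} else \<sigma> (map r [0..<i]))"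

text \<open>The robber may always stay where she is, so every finite play extends to an infinite
  one. It is therefore harmless to let plays continue after the robber has been caught.\<close>

definition robber_play ::
    "('v, 'e) multigraph \<Rightarrow> ('v, 'e) cop_strategy \<Rightarrow> (nat \<Rightarrow> 'v) \<Rightarrow> bool" where
  "robber_play G \<sigma> r \<longleftrightarrow> r 0 \<in> verts G \<and>
     (\<forall>i\<ge>1. robber_move G (cops_at \<sigma> r (i - 1)) (cops_at \<sigma> r i) (r (i - 1)) (r i))"

definition searchable :: "('v, 'e) multigraph \<Rightarrow> nat \<Rightarrow> nat \<Rightarrow> bool" where
  "searchable G p q \<longleftrightarrow> (\<exists>\<sigma>. cop_strategy G p \<sigma> \<and>
     (\<forall>r. robber_play G \<sigma> r \<longrightarrow> (\<exists>i\<ge>1. caught G q (cops_at \<sigma> r i) (r i))))"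

definition k_searchable :: "nat \<Rightarrow> ('v, 'e) multigraph \<Rightarrow> bool" where
  "k_searchable k G \<longleftrightarrow> searchable G k k"

end

theory Submission
  imports Defs "HOL-Library.Sublist"
begin

text \<open>
  Given a decomposition, the cops occupy the adhesion of a node and move one node towards the robber
  in each round; the robber never crosses a thin edge, since she stays in her three-edge-connected
  class, so the part of the tree available to her shrinks.

  Conversely, let \<open>C\<close> be such a class and call a vertex set small if it contains at most \<open>k\<close> vertices
  of \<open>C\<close>. If there is no tree whose leaves are small and whose nodes have border at most \<open>k\<close>, then a
  maximal down-closed family containing the small sets and still admitting no such tree leaves out,
  for every position \<open>F\<close> of the cops, a component of \<open>G - F\<close>, and any two sets left out
  intersect (submodularity of cuts). The robber escapes by staying in these components. So there is
  such a tree for each class. Each component of \<open>G - C\<close> is attached by at most two edges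
  (Menger) and can be moved into a single leaf without enlarging borders, and these components are
  then decomposed recursively and attached by thin edges.
\<close>

lemma grow_to_target:
  assumes "finite V" "s \<in> V" "P {s}"
    and step: "\<And>Q. P Q \<Longrightarrow> s \<in> Q \<Longrightarrow> Q \<subseteq> V \<Longrightarrow> t \<notin> Q \<Longrightarrow> \<exists>y\<in>V - Q. P (insert y Q)"
  shows "\<exists>Q\<subseteq>V. t \<in> Q \<and> P Q"
proof (rule ccontr)
  assume no: "\<not> ?thesis"
  let ?S = "{Q \<in> Pow V. s \<in> Q \<and> P Q}"
  have "finite ?S" "{s} \<in> ?S" using assms by auto
  then obtain Q where "Q \<in> ?S" "\<forall>R\<in>?S. Q \<subseteq> R \<longrightarrow> Q = R"
    using finite_has_maximal[of ?S] by (metis (no_types, lifting) empty_iff)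
  then have Q: "Q \<subseteq> V" "s \<in> Q" "P Q"
    and max: "\<And>R. R \<subseteq> V \<Longrightarrow> s \<in> R \<Longrightarrow> P R \<Longrightarrow> Q \<subseteq> R \<Longrightarrow> Q = R"
    by blast+
  have "t \<notin> Q" using no Q(1,3) by blast
  then obtain y where y: "y \<in> V - Q" "P (insert y Q)" using step[OF Q(3,2,1)] by blast
  have "Q = insert y Q" by (rule max) (use y Q in auto)
  then show False using y(1) by blast
qed

subsection \<open>Walks and cuts\<close>

lemma walk_append: "walk G u (p @ q) w \<longleftrightarrow> (\<exists>v. walk G u p v \<and> walk G v q w)" if "fin_multigraph G"
proof (induction p arbitrary: u)
  case Nil
  have "walk G u q w \<Longrightarrow> u \<in> verts G"
    using that by (cases q) (force simp: fin_multigraph_def)+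
  then show ?case by auto
qed auto

lemma walk_edges_simps [simp]:
  "walk_edges [] = {}" "walk_edges ((e, w) # p) = insert e (walk_edges p)"
  "walk_edges (p @ q) = walk_edges p \<union> walk_edges q"
  by (auto simp: walk_edges_def)

lemma walk_edges_ends:
  "walk G u p v \<Longrightarrow> e \<in> walk_edges p \<Longrightarrow> e \<in> edges G \<and> ends G e \<subseteq> set (u # map snd p)"
  by (induction G u p v rule: walk.induct) auto

lemma path_distinct_edges: "path G u p v \<Longrightarrow> distinct (map fst p)"
proof (induction p arbitrary: u)
  case (Cons a p)
  obtain e w where a: "a = (e, w)" by force
  have p: "path G w p v" "walk G w p v" "ends G e = {u, w}" "u \<notin> set (w # map snd p)"
    using Cons.prems by (auto simp: a path_def)
  then have "e \<notin> walk_edges p" using walk_edges_ends[OF p(2)] by blast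
  then show ?case using Cons.IH p by (simp add: a walk_edges_def)
qed auto

locale finite_multigraph =
  fixes G :: "('v, 'e) multigraph"
  assumes fin: "fin_multigraph G"
begin

definition src :: "'e \<Rightarrow> 'v" where
  "src e = (SOME x. x \<in> ends G e)"

definition tgt :: "'e \<Rightarrow> 'v" where
  "tgt e = (SOME y. ends G e = {src e, y} \<and> src e \<noteq> y)"

definition cut :: "'v set \<Rightarrow> 'e set" where
  "cut A = {e \<in> edges G. (src e \<in> A) \<noteq> (tgt e \<in> A)}"

lemma finite_verts [simp]: "finite (verts G)" and finite_edges [simp]: "finite (edges G)"
  using fin by (auto simp: fin_multigraph_def)

lemma src_tgt:
  assumes "e \<in> edges G"
  shows "ends G e = {src e, tgt e}" "src e \<noteq> tgt e" "src e \<in> verts G" "tgt e \<in> verts G"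
proof -
  have c: "card (ends G e) = 2" "ends G e \<subseteq> verts G" using assms fin by (auto simp: fin_multigraph_def)
  then have "ends G e \<noteq> {}" by auto
  then have s: "src e \<in> ends G e" unfolding src_def by (rule some_in_eq[THEN iffD2])
  then have "\<exists>y. ends G e = {src e, y} \<and> src e \<noteq> y"
    using c(1) unfolding card_2_iff by auto
  from someI_ex[OF this] have *: "ends G e = {src e, tgt e} \<and> src e \<noteq> tgt e"
    unfolding tgt_def .
  then show "ends G e = {src e, tgt e}" "src e \<noteq> tgt e" by auto
  then show "src e \<in> verts G" "tgt e \<in> verts G" using c by auto
qed

lemma ends_cases:
  assumes "e \<in> edges G" "ends G e = {x, y}"
  shows "x \<noteq> y" "x \<in> verts G" "y \<in> verts G" "src e = x \<and> tgt e = y \<or> src e = y \<and> tgt e = x"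
proof -
  have "{x, y} = {src e, tgt e}" using src_tgt(1)[OF assms(1)] assms(2) by simp
  then show *: "src e = x \<and> tgt e = y \<or> src e = y \<and> tgt e = x" by (auto simp: doubleton_eq_iff)
  show "x \<noteq> y" "x \<in> verts G" "y \<in> verts G" using * src_tgt(2-4)[OF assms(1)] by auto
qed

lemma in_cut_iff: "e \<in> edges G \<Longrightarrow> ends G e = {x, y} \<Longrightarrow> e \<in> cut A \<longleftrightarrow> (x \<in> A) \<noteq> (y \<in> A)"
  using ends_cases(4)[of e x y] by (auto simp: cut_def)

lemma cutE:
  assumes "e \<in> cut A"
  obtains x y where "e \<in> edges G" "ends G e = {x, y}" "x \<in> A" "y \<notin> A" "x \<in> verts G" "y \<in> verts G"
proof -
  have e: "e \<in> edges G" using assms by (simp add: cut_def)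
  show thesis
  proof (cases "src e \<in> A")
    case True then show thesis using assms src_tgt[OF e] by (intro that[of "src e" "tgt e"]) (auto simp: cut_def)
  next
    case False then show thesis using assms src_tgt[OF e] by (intro that[of "tgt e" "src e"]) (auto simp: cut_def)
  qed
qed

lemma cut_subset: "cut A \<subseteq> edges G" and finite_cut [simp]: "finite (cut A)"
  by (auto simp: cut_def)

lemma cut_verts: "cut (A \<inter> verts G) = cut A"
  using src_tgt by (auto simp: cut_def)

lemma cut_compl: "cut (- A) = cut A" and cut_empty [simp]: "cut {} = {}"
  by (auto simp: cut_def)

lemma cut_Diff_verts: "cut (verts G - A) = cut A"
  using cut_verts[of "- A"] by (simp add: cut_compl Diff_eq Int_commute)

lemma cut_verts_all [simp]: "cut (verts G) = {}"
  using cut_Diff_verts[of "{}"] by simp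

lemma walk_crosses_cut:
  "walk G u p v \<Longrightarrow> u \<in> A \<Longrightarrow> v \<notin> A \<Longrightarrow> walk_edges p \<inter> cut A \<noteq> {}"
proof (induction p arbitrary: u)
  case (Cons a p)
  obtain e w where a: "a = (e, w)" by force
  show ?case
  proof (cases "w \<in> A")
    case True then show ?thesis using Cons by (auto simp: a)
  next
    case False then show ?thesis using Cons.prems in_cut_iff[of e u w A] by (auto simp: a)
  qed
qed auto

lemma walk_verts: "walk G u p v \<Longrightarrow> u \<in> verts G \<and> v \<in> verts G"
proof (induction p arbitrary: u)
  case (Cons a p)
  then show ?case using ends_cases(2)[of "fst a" u "snd a"] by (cases a) auto
qed auto

lemma path_snoc:
  assumes "path G u p x" "e \<in> edges G" "ends G e = {x, y}" "y \<noteq> u" "y \<notin> set (map snd p)"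
  shows "path G u (p @ [(e, y)]) y"
  using assms ends_cases(1,3)[OF assms(2,3)] by (auto simp: path_def walk_append[OF fin])

lemma reachable_avoiding_iff:
  "reachable_avoiding G F u v \<longleftrightarrow>
     u \<in> verts G \<and> v \<in> verts G \<and> (\<forall>A. u \<in> A \<longrightarrow> cut A \<subseteq> F \<longrightarrow> v \<in> A)"
proof
  assume "reachable_avoiding G F u v"
  then show "u \<in> verts G \<and> v \<in> verts G \<and> (\<forall>A. u \<in> A \<longrightarrow> cut A \<subseteq> F \<longrightarrow> v \<in> A)"
    using walk_verts walk_crosses_cut unfolding reachable_avoiding_def path_def by blast
next
  assume R: "u \<in> verts G \<and> v \<in> verts G \<and> (\<forall>A. u \<in> A \<longrightarrow> cut A \<subseteq> F \<longrightarrow> v \<in> A)"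
  define ok where "ok Q x \<longleftrightarrow>
    (\<exists>p. path G u p x \<and> walk_edges p \<inter> F = {} \<and> set (map snd p) \<subseteq> Q)" for Q x
  have "\<exists>Q\<subseteq>verts G. v \<in> Q \<and> (\<forall>x\<in>Q. ok Q x)"
  proof (rule grow_to_target[where P = "\<lambda>Q. \<forall>x\<in>Q. ok Q x" and s = u])
    show "\<forall>x\<in>{u}. ok {u} x" using R by (auto simp: ok_def path_def intro!: exI[of _ "[]"])
  next
    fix Q assume Q: "\<forall>x\<in>Q. ok Q x" "u \<in> Q" "Q \<subseteq> verts G" "v \<notin> Q"
    then obtain e where "e \<in> cut Q" "e \<notin> F" using R by blast
    then obtain x y where e: "e \<in> edges G" "ends G e = {x, y}" "x \<in> Q" "y \<notin> Q" "y \<in> verts G"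
      by (elim cutE)
    obtain p where p: "path G u p x" "walk_edges p \<inter> F = {}" "set (map snd p) \<subseteq> Q"
      using Q(1) e(3) unfolding ok_def by blast
    have "path G u (p @ [(e, y)]) y" using path_snoc[OF p(1) e(1,2)] p Q e by blast
    moreover have "walk_edges (p @ [(e, y)]) \<inter> F = {}" "set (map snd (p @ [(e, y)])) \<subseteq> insert y Q"
      using p \<open>e \<notin> F\<close> by auto
    ultimately have "ok (insert y Q) y" unfolding ok_def by blast
    moreover have "ok (insert y Q) z" if "ok Q z" for z
      using that unfolding ok_def by (meson subset_insertI2)
    ultimately show "\<exists>y\<in>verts G - Q. \<forall>x\<in>insert y Q. ok (insert y Q) x" using e Q(1) by blast
  qed (use R in simp_all)
  then show "reachable_avoiding G F u v" unfolding ok_def reachable_avoiding_def by blast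
qed

lemma reachable_closed: "reachable_avoiding G F u v \<Longrightarrow> u \<in> A \<Longrightarrow> cut A \<subseteq> F \<Longrightarrow> v \<in> A"
  unfolding reachable_avoiding_iff by blast

lemma reachable_sym: "reachable_avoiding G F u v \<Longrightarrow> reachable_avoiding G F v u"
  unfolding reachable_avoiding_iff by (metis ComplD ComplI cut_compl)

lemma reachable_trans:
  "reachable_avoiding G F u v \<Longrightarrow> reachable_avoiding G F v w \<Longrightarrow> reachable_avoiding G F u w"
  unfolding reachable_avoiding_iff by blast

lemma reachable_refl: "u \<in> verts G \<Longrightarrow> reachable_avoiding G F u u"
  unfolding reachable_avoiding_iff by blast

lemma reachable_mono:
  "reachable_avoiding G F u v \<Longrightarrow> F' \<subseteq> F \<Longrightarrow> reachable_avoiding G F' u v"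
  unfolding reachable_avoiding_iff by blast

lemma reachable_edge:
  assumes "e \<in> edges G" "ends G e = {u, v}" "e \<notin> F"
  shows "reachable_avoiding G F u v"
  unfolding reachable_avoiding_iff using assms ends_cases[OF assms(1,2)] in_cut_iff[OF assms(1,2)] by blast

lemma cut_reachable_set: "cut {v. reachable_avoiding G F u v} \<subseteq> F"
proof
  fix e assume "e \<in> cut {v. reachable_avoiding G F u v}"
  then obtain x y where "e \<in> edges G" "ends G e = {x, y}"
    "reachable_avoiding G F u x" "\<not> reachable_avoiding G F u y" by (elim cutE) auto
  then show "e \<in> F" using reachable_edge reachable_trans by metis
qed


subsection \<open>Menger's theorem\<close>

definition balance :: "('e \<Rightarrow> int) \<Rightarrow> 'v \<Rightarrow> int" where
  "balance f v = (\<Sum>e\<in>edges G. f e * (of_bool (src e = v) - of_bool (tgt e = v)))"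

definition flow :: "'v \<Rightarrow> 'v \<Rightarrow> int \<Rightarrow> ('e \<Rightarrow> int) \<Rightarrow> bool" where
  "flow s t n f \<longleftrightarrow> (\<forall>e. \<bar>f e\<bar> \<le> 1) \<and>
     (\<forall>v. balance f v = n * (of_bool (v = s) - of_bool (v = t)))"

lemma balance_upd:
  assumes "e \<in> edges G"
  shows "balance (f(e := f e + c)) v = balance f v + c * (of_bool (src e = v) - of_bool (tgt e = v))"
proof -
  let ?g = "\<lambda>a. of_bool (src a = v) - of_bool (tgt a = v) :: int"
  have "balance (f(e := f e + c)) v = (\<Sum>a\<in>edges G. f a * ?g a + (if a = e then c * ?g e else 0))"
    unfolding balance_def by (intro sum.cong) (auto simp: algebra_simps)
  also have "\<dots> = balance f v + c * ?g e"
    unfolding balance_def sum.distrib using assms by (simp add: sum.delta)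
  finally show ?thesis .
qed

lemma sum_balance:
  assumes "finite A"
  shows "(\<Sum>v\<in>A. balance f v) = (\<Sum>e\<in>cut A. f e * (if src e \<in> A then 1 else -1))"
proof -
  have "(\<Sum>v\<in>A. balance f v) =
      (\<Sum>e\<in>edges G. \<Sum>v\<in>A. f e * (of_bool (src e = v) - of_bool (tgt e = v)))"
    unfolding balance_def by (rule sum.swap)
  also have "\<dots> = (\<Sum>e\<in>edges G. f e * (of_bool (src e \<in> A) - of_bool (tgt e \<in> A)))"
  proof (rule sum.cong[OF refl])
    have 1: "(\<Sum>v\<in>A. of_bool (x = v)) = (of_bool (x \<in> A) :: int)" for x
      using assms sum.delta'[of A x "\<lambda>_. 1 :: int"] by (auto simp: of_bool_def)
    show "(\<Sum>v\<in>A. f e * (of_bool (src e = v) - of_bool (tgt e = v))) =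
      f e * (of_bool (src e \<in> A) - of_bool (tgt e \<in> A))" for e
      by (simp add: sum_distrib_left[symmetric] sum_subtractf 1)
  qed
  also have "\<dots> = (\<Sum>e\<in>cut A. f e * (if src e \<in> A then 1 else -1))"
    by (rule sum.mono_neutral_cong_right) (auto simp: cut_def)
  finally show ?thesis .
qed

lemma flow_across_cut:
  assumes "flow s t n f" "A \<subseteq> verts G" "s \<in> A" "t \<notin> A"
  shows "(\<Sum>e\<in>cut A. f e * (if src e \<in> A then 1 else -1)) = n"
proof -
  have A: "finite A" using assms(2) finite_subset by fastforce
  have "(\<Sum>v\<in>A. balance f v) = (\<Sum>v\<in>A. if v = s then n else 0)"
    using assms by (intro sum.cong) (auto simp: flow_def)
  then show ?thesis using sum_balance[OF A, of f] A assms(3) by simp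
qed

lemma flow_augment:
  assumes f: "flow s t n f" and st: "s \<in> verts G" "t \<in> verts G" "s \<noteq> t"
    and cuts: "\<And>A. s \<in> A \<Longrightarrow> t \<notin> A \<Longrightarrow> n < int (card (cut A))"
  shows "\<exists>f'. flow s t (n + 1) f'"
proof -
  define ok where "ok Q x \<longleftrightarrow> (\<exists>g. (\<forall>e. \<bar>g e\<bar> \<le> 1) \<and>
    (\<forall>v. balance g v = balance f v + of_bool (v = s) - of_bool (v = x)) \<and>
    (\<forall>e. \<not> (src e \<in> Q \<and> tgt e \<in> Q) \<longrightarrow> g e = f e))" for Q x
  have f1: "\<bar>f e\<bar> \<le> 1" for e using f by (simp add: flow_def)
  have "\<exists>Q\<subseteq>verts G. t \<in> Q \<and> (\<forall>x\<in>Q. ok Q x)"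
  proof (rule grow_to_target[where P = "\<lambda>Q. \<forall>x\<in>Q. ok Q x" and s = s])
    show "\<forall>x\<in>{s}. ok {s} x" using f1 by (auto simp: ok_def)
  next
    fix Q assume Q: "\<forall>x\<in>Q. ok Q x" "s \<in> Q" "Q \<subseteq> verts G" "t \<notin> Q"
    let ?sg = "\<lambda>e. if src e \<in> Q then 1 else -1 :: int"
    have "\<exists>e\<in>cut Q. f e * ?sg e \<noteq> 1"
    proof (rule ccontr)
      assume "\<not> ?thesis"
      then have "(\<Sum>e\<in>cut Q. f e * ?sg e) = (\<Sum>e\<in>cut Q. 1)" by (intro sum.cong) auto
      then show False using flow_across_cut[OF f Q(3,2,4)] cuts[OF Q(2,4)] by simp
    qed
    then obtain e where e: "e \<in> cut Q" "f e * ?sg e \<noteq> 1" by blast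
    then have le: "\<bar>f e + ?sg e\<bar> \<le> 1" using f1[of e] by (auto split: if_splits)
    have E: "e \<in> edges G" using e(1) by (simp add: cut_def)
    obtain x y where xy: "x \<in> Q" "y \<notin> Q" "y \<in> verts G"
      "src e \<in> Q \<and> x = src e \<and> y = tgt e \<or> src e \<notin> Q \<and> x = tgt e \<and> y = src e"
      using e(1) src_tgt[OF E] by (cases "src e \<in> Q") (auto simp: cut_def)
    obtain g where g: "\<forall>e. \<bar>g e\<bar> \<le> 1"
      "\<forall>v. balance g v = balance f v + of_bool (v = s) - of_bool (v = x)"
      "\<forall>e. \<not> (src e \<in> Q \<and> tgt e \<in> Q) \<longrightarrow> g e = f e" using Q(1) xy(1) unfolding ok_def by blast
    let ?h = "g(e := g e + ?sg e)"
    have ge: "g e = f e" using g(3) xy by auto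
    have "balance ?h v = balance f v + of_bool (v = s) - of_bool (v = y)" for v
      unfolding balance_upd[OF E] using g(2) xy by auto
    moreover have "\<forall>a. \<bar>?h a\<bar> \<le> 1" using g(1) ge le by (auto split: if_splits)
    moreover have "\<forall>a. \<not> (src a \<in> insert y Q \<and> tgt a \<in> insert y Q) \<longrightarrow> ?h a = f a"
      using g(3) xy by auto
    ultimately have "ok (insert y Q) y" unfolding ok_def by blast
    moreover have "ok (insert y Q) z" if "ok Q z" for z
      using that unfolding ok_def by (metis insertI2)
    ultimately show "\<exists>y\<in>verts G - Q. \<forall>x\<in>insert y Q. ok (insert y Q) x" using xy(2,3) Q(1) by blast
  qed (use st in simp_all)
  then obtain g where g: "\<forall>e. \<bar>g e\<bar> \<le> 1"
    "\<forall>v. balance g v = balance f v + of_bool (v = s) - of_bool (v = t)" unfolding ok_def by blast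
  then have "flow s t (n + 1) g" using f st(3) by (auto simp: flow_def)
  then show ?thesis by blast
qed

lemma flow_path:
  assumes f: "flow s t n f" and st: "s \<in> verts G" "t \<in> verts G" "s \<noteq> t" and n: "n > 0"
  shows "\<exists>p g. path G s p t \<and> flow s t (n - 1) g \<and> walk_edges p \<subseteq> {e. f e \<noteq> 0} \<and>
    {e. g e \<noteq> 0} \<subseteq> {e. f e \<noteq> 0} - walk_edges p"
proof -
  define ok where "ok Q x \<longleftrightarrow> (\<exists>p g. path G s p x \<and> set (map snd p) \<subseteq> Q \<and>
    walk_edges p \<subseteq> {e. f e \<noteq> 0} \<and> (\<forall>e. g e = (if e \<in> walk_edges p then 0 else f e)) \<and>
    (\<forall>v. balance g v = balance f v - of_bool (v = s) + of_bool (v = x)))" for Q x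
  have "\<exists>Q\<subseteq>verts G. t \<in> Q \<and> (\<forall>x\<in>Q. ok Q x)"
  proof (rule grow_to_target[where P = "\<lambda>Q. \<forall>x\<in>Q. ok Q x" and s = s])
    show "\<forall>x\<in>{s}. ok {s} x" using st by (auto simp: ok_def path_def intro!: exI[of _ "[]"] exI[of _ f])
  next
    fix Q assume Q: "\<forall>x\<in>Q. ok Q x" "s \<in> Q" "Q \<subseteq> verts G" "t \<notin> Q"
    let ?sg = "\<lambda>e. if src e \<in> Q then 1 else -1 :: int"
    have "\<exists>e\<in>cut Q. f e * ?sg e > 0"
    proof (rule ccontr)
      assume "\<not> ?thesis"
      then have "(\<Sum>e\<in>cut Q. f e * ?sg e) \<le> 0" by (intro sum_nonpos) force
      then show False using flow_across_cut[OF f Q(3,2,4)] n by simp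
    qed
    then obtain e where e: "e \<in> cut Q" "f e * ?sg e > 0" by blast
    have "\<bar>f e\<bar> \<le> 1" using f by (simp add: flow_def)
    then have fe: "f e = ?sg e" using e(2) by (auto split: if_splits)
    have E: "e \<in> edges G" using e(1) by (simp add: cut_def)
    obtain x y where xy: "x \<in> Q" "y \<notin> Q" "y \<in> verts G"
      "src e \<in> Q \<and> x = src e \<and> y = tgt e \<or> src e \<notin> Q \<and> x = tgt e \<and> y = src e"
      using e(1) src_tgt[OF E] by (cases "src e \<in> Q") (auto simp: cut_def)
    then have ends: "ends G e = {x, y}" using src_tgt[OF E] by auto
    obtain p g where p: "path G s p x" "set (map snd p) \<subseteq> Q" "walk_edges p \<subseteq> {e. f e \<noteq> 0}"
      and g: "\<forall>e. g e = (if e \<in> walk_edges p then 0 else f e)"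
        "\<forall>v. balance g v = balance f v - of_bool (v = s) + of_bool (v = x)"
      using Q(1) xy(1) unfolding ok_def by blast
    have ep: "e \<notin> walk_edges p"
      using walk_edges_ends[of G s p x e] p(1,2) Q(2) ends xy(2) by (auto simp: path_def)
    let ?h = "g(e := g e + - ?sg e)"
    have "path G s (p @ [(e, y)]) y" using path_snoc[OF p(1) E ends] p(2) Q(2) xy(2) by blast
    moreover have "balance ?h v = balance f v - of_bool (v = s) + of_bool (v = y)" for v
      unfolding balance_upd[OF E] using g(2) xy by auto
    moreover have "\<forall>a. ?h a = (if a \<in> walk_edges (p @ [(e, y)]) then 0 else f a)"
      using g(1) ep fe by auto
    moreover have "set (map snd (p @ [(e, y)])) \<subseteq> insert y Q" using p(2) by auto
    moreover have "walk_edges (p @ [(e, y)]) \<subseteq> {e. f e \<noteq> 0}" using p(3) fe by (auto split: if_splits)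
    ultimately have "ok (insert y Q) y" unfolding ok_def by blast
    moreover have "ok (insert y Q) z" if "ok Q z" for z
      using that unfolding ok_def by (meson subset_insertI2)
    ultimately show "\<exists>y\<in>verts G - Q. \<forall>x\<in>insert y Q. ok (insert y Q) x" using xy(2,3) Q(1) by blast
  qed (use st in simp_all)
  then obtain p g where p: "path G s p t" "walk_edges p \<subseteq> {e. f e \<noteq> 0}"
    and g: "\<forall>e. g e = (if e \<in> walk_edges p then 0 else f e)"
      "\<forall>v. balance g v = balance f v - of_bool (v = s) + of_bool (v = t)" unfolding ok_def by blast
  have "flow s t (n - 1) g" using f g st(3) by (auto simp: flow_def)
  then show ?thesis using p g(1) by (intro exI[of _ p] exI[of _ g]) auto
qed

lemma flow_exists:
  assumes "s \<in> verts G" "t \<in> verts G" "s \<noteq> t"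
    and "\<And>A. s \<in> A \<Longrightarrow> t \<notin> A \<Longrightarrow> n \<le> card (cut A)"
  shows "\<exists>f. flow s t (int n) f"
  using assms(4)
proof (induction n)
  case 0
  then show ?case by (auto simp: flow_def balance_def intro!: exI[of _ "\<lambda>_. 0"])
next
  case (Suc n)
  then obtain f where "flow s t (int n) f" using Suc_leD by blast
  from flow_augment[OF this assms(1-3)] Suc.prems show ?case
    by (metis Suc_le_eq of_nat_Suc add.commute of_nat_less_iff)
qed

lemma three_edge_connected_iff:
  assumes "u \<in> verts G" "v \<in> verts G"
  shows "three_edge_connected G u v \<longleftrightarrow> (\<forall>A. card (cut A) \<le> 2 \<longrightarrow> (u \<in> A \<longleftrightarrow> v \<in> A))"
proof (cases "u = v")
  case False
  show ?thesis
  proof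
    assume "three_edge_connected G u v"
    then obtain p1 p2 p3 where p: "walk G u p1 v" "walk G u p2 v" "walk G u p3 v"
      "walk_edges p1 \<inter> walk_edges p2 = {}" "walk_edges p1 \<inter> walk_edges p3 = {}"
      "walk_edges p2 \<inter> walk_edges p3 = {}"
      using False by (auto simp: three_edge_connected_def path_def)
    have *: "card (cut A) \<ge> 3" if A: "u \<in> A" "v \<notin> A" for A
    proof -
      obtain a b c where "a \<in> walk_edges p1 \<inter> cut A" "b \<in> walk_edges p2 \<inter> cut A"
        "c \<in> walk_edges p3 \<inter> cut A"
        using walk_crosses_cut[OF p(1) A] walk_crosses_cut[OF p(2) A]
          walk_crosses_cut[OF p(3) A] by blast
      moreover from this have "a \<noteq> b" "a \<noteq> c" "b \<noteq> c" using p(4-6) by blast+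
      ultimately have "card {a, b, c} = 3" "{a, b, c} \<subseteq> cut A" by auto
      then show ?thesis using card_mono[OF finite_cut[of A]] by metis
    qed
    show "\<forall>A. card (cut A) \<le> 2 \<longrightarrow> (u \<in> A \<longleftrightarrow> v \<in> A)"
    proof (intro allI impI)
      fix A assume "card (cut A) \<le> 2"
      then show "u \<in> A \<longleftrightarrow> v \<in> A" using *[of A] *[of "- A"] unfolding cut_compl by fastforce
    qed
  next
    assume A: "\<forall>A. card (cut A) \<le> 2 \<longrightarrow> (u \<in> A \<longleftrightarrow> v \<in> A)"
    have "\<exists>f. flow u v (int 3) f"
    proof (rule flow_exists[OF assms False])
      fix B assume "u \<in> B" "v \<notin> B"
      then have "\<not> card (cut B) \<le> 2" using A by blast
      then show "3 \<le> card (cut B)" by simp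
    qed
    then obtain f where f: "flow u v 3 f" by auto
    obtain p1 f1 where 1: "path G u p1 v" "flow u v 2 f1" "walk_edges p1 \<subseteq> {e. f e \<noteq> 0}"
        "{e. f1 e \<noteq> 0} \<subseteq> {e. f e \<noteq> 0} - walk_edges p1"
      using flow_path[OF f assms False] by auto
    obtain p2 f2 where 2: "path G u p2 v" "flow u v 1 f2" "walk_edges p2 \<subseteq> {e. f1 e \<noteq> 0}"
        "{e. f2 e \<noteq> 0} \<subseteq> {e. f1 e \<noteq> 0} - walk_edges p2"
      using flow_path[OF 1(2) assms False] by auto
    obtain p3 where 3: "path G u p3 v" "walk_edges p3 \<subseteq> {e. f2 e \<noteq> 0}"
      using flow_path[OF 2(2) assms False] by auto
    have "walk_edges p1 \<inter> walk_edges p2 = {}" "walk_edges p1 \<inter> walk_edges p3 = {}"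
      "walk_edges p2 \<inter> walk_edges p3 = {}" using 1(4) 2(3,4) 3(2) by blast+
    then show "three_edge_connected G u v"
      unfolding three_edge_connected_def using 1(1) 2(1) 3(1) by blast
  qed
qed (simp add: three_edge_connected_def)


subsection \<open>Partitioning trees\<close>

inductive ptree :: "nat \<Rightarrow> 'v set set \<Rightarrow> 'v set \<Rightarrow> bool" for k S where
  leaf: "X \<in> S \<Longrightarrow> card (cut X) \<le> k \<Longrightarrow> ptree k S X"
| node: "\<forall>Y\<in>P. ptree k S Y \<Longrightarrow> disjoint P \<Longrightarrow> card (\<Union>(cut ` P)) \<le> k \<Longrightarrow> ptree k S (\<Union>P)"

lemma finite_border [simp]: "finite (\<Union>(cut ` P))"
  by (rule finite_subset[of _ "edges G"]) (use cut_subset in auto)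

lemma cut_Union_subset: "cut (\<Union>P) \<subseteq> \<Union>(cut ` P)"
  by (auto simp: cut_def)

lemma ptree_card_cut: "ptree k S X \<Longrightarrow> card (cut X) \<le> k"
proof (induction rule: ptree.induct)
  case (node P)
  then show ?case using card_mono[OF finite_border cut_Union_subset, of P] by simp
qed

lemma ptree_subset: "ptree k S X \<Longrightarrow> S \<subseteq> Pow W \<Longrightarrow> X \<subseteq> W"
  by (induction rule: ptree.induct) auto

lemma border_Diff:
  assumes "card (cut Z) \<le> card (cut (Z - \<Union>P))"
  shows "card (\<Union>Y\<in>P. cut (Y - Z)) \<le> card (\<Union>Y\<in>P. cut Y)"
proof -
  let ?N = "\<Union>Y\<in>P. cut Y" and ?N' = "\<Union>Y\<in>P. cut (Y - Z)"
  have fin: "finite ?N" "finite ?N'"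
    using finite_border[of P] finite_border[of "(\<lambda>Y. Y - Z) ` P"] by simp_all
  have "?N' - ?N \<subseteq> cut Z - cut (Z - \<Union>P)" "cut (Z - \<Union>P) - cut Z \<subseteq> ?N - ?N'"
    by (auto simp: cut_def)
  then have "card (?N' - ?N) \<le> card (cut Z - cut (Z - \<Union>P))"
    "card (cut (Z - \<Union>P) - cut Z) \<le> card (?N - ?N')"
    using fin by (auto intro!: card_mono)
  moreover have "card (cut Z - cut (Z - \<Union>P)) \<le> card (cut (Z - \<Union>P) - cut Z)"
    using assms by (simp add: card_le_sym_Diff)
  ultimately have "card (?N' - ?N) \<le> card (?N - ?N')" by linarith
  moreover have "card ?N' = card (?N' \<inter> ?N) + card (?N' - ?N)"
    using fin by (metis card_Int_Diff)
  moreover have "card ?N = card (?N \<inter> ?N') + card (?N - ?N')"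
    using fin by (metis card_Int_Diff)
  ultimately show ?thesis by (simp add: Int_commute)
qed

lemma ptree_Diff:
  assumes "ptree k S Y" and down: "\<And>X Y. X \<in> S \<Longrightarrow> Y \<subseteq> X \<Longrightarrow> Y \<in> S"
    and "A \<subseteq> Z" and min: "\<And>W. A \<subseteq> W \<Longrightarrow> W \<subseteq> Z \<Longrightarrow> card (cut Z) \<le> card (cut W)"
    and "Y \<inter> A = {}"
  shows "ptree k S (Y - Z)"
  using assms(1,5)
proof (induction rule: ptree.induct)
  case (leaf X)
  have "card (cut Z) \<le> card (cut (Z - \<Union>{X}))" by (rule min) (use \<open>A \<subseteq> Z\<close> leaf in auto)
  from border_Diff[OF this] leaf show ?case by (intro ptree.leaf) (auto intro: down)
next
  case (node P)
  let ?P = "(\<lambda>Y. Y - Z) ` P"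
  have "card (cut Z) \<le> card (cut (Z - \<Union>P))" by (rule min) (use \<open>A \<subseteq> Z\<close> node in auto)
  from border_Diff[OF this] have "card (\<Union>(cut ` ?P)) \<le> k" using node by (simp add: image_image)
  moreover have "disjoint ?P" using \<open>disjoint P\<close> unfolding disjoint_def by auto
  moreover have "\<forall>Y\<in>?P. ptree k S Y" using node by blast
  ultimately have "ptree k S (\<Union>?P)" by (intro ptree.node)
  moreover have "\<Union>?P = \<Union>P - Z" by blast
  ultimately show ?case by simp
qed

lemma ptree_join:
  assumes down: "\<And>X Y. X \<in> S \<Longrightarrow> Y \<subseteq> X \<Longrightarrow> Y \<in> S"
    and AB: "A \<subseteq> verts G" "B \<subseteq> verts G" "A \<inter> B = {}"
    and "ptree k S (verts G - A)" "ptree k S (verts G - B)"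
  shows "ptree k S (verts G)"
proof -
  let ?V = "verts G"
  define Q where "Q Z \<longleftrightarrow> A \<subseteq> Z \<and> Z \<subseteq> ?V \<and> Z \<inter> B = {}" for Z
  have "Q A" using AB by (auto simp: Q_def)
  then obtain Z where "Q Z" and min: "\<And>W. Q W \<Longrightarrow> card (cut Z) \<le> card (cut W)"
    using ex_has_least_nat[of Q A "\<lambda>Z. card (cut Z)"] by blast
  then have Z: "A \<subseteq> Z" "Z \<subseteq> ?V" "Z \<inter> B = {}" by (auto simp: Q_def)
  have "ptree k S (?V - A - Z)"
  proof (rule ptree_Diff[OF assms(5), where A = A])
    show "Y \<in> S" if "X \<in> S" "Y \<subseteq> X" for X Y using that by (rule down)
    show "card (cut Z) \<le> card (cut W)" if "A \<subseteq> W" "W \<subseteq> Z" for W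
      by (rule min) (use that Z in \<open>auto simp: Q_def\<close>)
  qed (use Z in blast)+
  moreover have "?V - A - Z = ?V - Z" using Z by blast
  moreover have "ptree k S (?V - B - (?V - Z))"
  proof (rule ptree_Diff[OF assms(6), where A = B])
    show "Y \<in> S" if "X \<in> S" "Y \<subseteq> X" for X Y using that by (rule down)
    fix W assume W: "B \<subseteq> W" "W \<subseteq> ?V - Z"
    have "card (cut Z) \<le> card (cut (?V - W))" by (rule min) (use W Z AB in \<open>auto simp: Q_def\<close>)
    then show "card (cut (?V - Z)) \<le> card (cut W)" by (simp add: cut_Diff_verts)
  qed (use AB Z in blast)+
  moreover have "?V - B - (?V - Z) = Z" using Z by blast
  ultimately have Zt: "ptree k S Z" "ptree k S (?V - Z)" by simp_all
  have "ptree k S (\<Union>{Z, ?V - Z})"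
    by (rule ptree.node) (use Zt ptree_card_cut[OF Zt(1)] in \<open>auto simp: cut_Diff_verts disjoint_def\<close>)
  moreover have "\<Union>{Z, ?V - Z} = ?V" using Z(2) by auto
  ultimately show ?thesis by simp
qed

text \<open>Moves the root from a node to its child \<open>Y\<close>.\<close>

lemma ptree_swap_child:
  assumes P: "disjoint P" "card (\<Union>(cut ` P)) \<le> k" "\<Union>P \<subseteq> verts G" "Y \<in> P"
    and "\<And>Z. Z \<in> P \<Longrightarrow> Z \<noteq> Y \<Longrightarrow> ptree k S Z" "ptree k S (verts G - \<Union>P)"
  shows "ptree k S (verts G - Y)"
proof -
  let ?P = "insert (verts G - \<Union>P) (P - {Y})"
  have "\<Union>(cut ` ?P) \<subseteq> \<Union>(cut ` P)" using cut_Union_subset[of P] by (auto simp: cut_Diff_verts)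
  then have "card (\<Union>(cut ` ?P)) \<le> k" using P(2) card_mono[OF finite_border] by (meson order_trans)
  moreover have "disjoint ?P"
    using P(1) by (auto simp: disjoint_def)
  moreover have "\<forall>Z\<in>?P. ptree k S Z" using assms(5,6) by simp
  ultimately have "ptree k S (\<Union>?P)" by (intro ptree.node)
  moreover have "Z \<inter> Y = {}" if "Z \<in> P - {Y}" for Z
    using P(1,4) that by (auto simp: disjoint_def)
  then have "\<Union>?P = verts G - Y" using P(3,4) by auto
  ultimately show ?thesis by simp
qed

lemma ptree_new_leaf:
  assumes "ptree k (insert A S) X" "A \<noteq> {}" "A \<subseteq> verts G" "S \<subseteq> Pow (verts G)"
  shows "ptree k S X \<or> A \<subseteq> X \<and> (ptree k S (verts G - X) \<longrightarrow> ptree k S (verts G - A))"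
  using assms(1)
proof (induction rule: ptree.induct)
  case (leaf X)
  then show ?case by (auto intro: ptree.leaf)
next
  case (node P)
  show ?case
  proof (cases "\<forall>Y\<in>P. ptree k S Y")
    case True
    then show ?thesis using node by (auto intro: ptree.node)
  next
    case False
    then obtain Y where Y: "Y \<in> P" "\<not> ptree k S Y" by blast
    then have A: "A \<subseteq> Y" "ptree k S (verts G - Y) \<longrightarrow> ptree k S (verts G - A)" using node by auto
    have others: "ptree k S Z" if "Z \<in> P" "Z \<noteq> Y" for Z
      using node that Y(1) A(1) \<open>A \<noteq> {}\<close> unfolding disjoint_def by blast
    have "\<Union>P \<subseteq> verts G" using node.IH ptree_subset assms(3,4) by blast
    then have "ptree k S (verts G - \<Union>P) \<longrightarrow> ptree k S (verts G - Y)"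
      using ptree_swap_child[OF node.hyps(1,2) _ Y(1) others] by blast
    then show ?thesis using A Y(1) by blast
  qed
qed

lemma ptree_leaf_through:
  assumes "ptree k S X" "ptree k S (verts G - X)" "b \<in> X" "S \<subseteq> Pow (verts G)"
  shows "\<exists>L\<in>S. b \<in> L \<and> ptree k S (verts G - L)"
  using assms(1-3)
proof (induction rule: ptree.induct)
  case (node P)
  then obtain Y where Y: "Y \<in> P" "b \<in> Y" by blast
  have P: "\<forall>Y\<in>P. ptree k S Y" using node.IH by blast
  then have "\<Union>P \<subseteq> verts G" using ptree_subset assms(4) by blast
  then have "ptree k S (verts G - Y)"
    using ptree_swap_child[OF node.hyps(1,2) _ Y(1)] P node.prems by blast
  then show ?case using node.IH Y by blast
qed auto

text \<open>Enlarge \<open>S\<close> to a maximal down-closed family without a partitioning tree; a set \<open>A\<close> that is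
  minimal outside of the maximal family can then be cut off by a tree all of whose other leaves
  belong to the family, so \<open>ptree_join\<close> forbids two disjoint such sets.\<close>

lemma ptree_obstruction:
  assumes "S \<subseteq> Pow (verts G)" "\<And>X Y. X \<in> S \<Longrightarrow> Y \<subseteq> X \<Longrightarrow> Y \<in> S" "{} \<in> S"
    and "\<not> ptree k S (verts G)"
  obtains S' where "S \<subseteq> S'" "\<not> ptree k S' (verts G)"
    "\<And>A B. A \<subseteq> verts G \<Longrightarrow> B \<subseteq> verts G \<Longrightarrow> A \<notin> S' \<Longrightarrow> B \<notin> S' \<Longrightarrow> A \<inter> B \<noteq> {}"
proof -
  let ?V = "verts G"
  let ?Q = "\<lambda>R. S \<subseteq> R \<and> R \<subseteq> Pow ?V \<and> (\<forall>X\<in>R. \<forall>Y\<subseteq>X. Y \<in> R) \<and> \<not> ptree k R ?V"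
  have "finite {R. ?Q R}" by (rule finite_subset[of _ "Pow (Pow ?V)"]) auto
  moreover have "S \<in> {R. ?Q R}" using assms by auto
  ultimately obtain R where R: "R \<in> {R. ?Q R}" and max': "\<forall>R'\<in>{R. ?Q R}. R \<subseteq> R' \<longrightarrow> R = R'"
    using finite_has_maximal[of "{R. ?Q R}"] by (metis (no_types, lifting) empty_iff)
  have max: "R = R'" if "?Q R'" "R \<subseteq> R'" for R' using max' that by blast
  have down: "Y \<in> R" if "X \<in> R" "Y \<subseteq> X" for X Y using R that by blast
  have "{} \<in> R" using R assms(3) by blast
  have cut_off: "\<exists>A0\<subseteq>A. ptree k R (?V - A0)" if A: "A \<subseteq> ?V" "A \<notin> R" for A
  proof -
    have "finite A" using A(1) finite_verts by (rule finite_subset)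
    then have "finite {B. B \<subseteq> A \<and> B \<notin> R}" by simp
    moreover have "A \<in> {B. B \<subseteq> A \<and> B \<notin> R}" using A by simp
    ultimately obtain A0 where A0: "A0 \<in> {B. B \<subseteq> A \<and> B \<notin> R}"
      and min': "\<forall>B\<in>{B. B \<subseteq> A \<and> B \<notin> R}. B \<subseteq> A0 \<longrightarrow> A0 = B"
      using finite_has_minimal[of "{B. B \<subseteq> A \<and> B \<notin> R}"] by (metis (no_types, lifting) empty_iff)
    have min: "B \<in> R" if "B \<subset> A0" for B using A0 min' that by auto
    have A0: "A0 \<subseteq> A" "A0 \<notin> R" using A0 by auto
    have "ptree k (insert A0 R) ?V"
    proof (rule ccontr)
      assume n: "\<not> ?thesis"
      have "Y \<in> insert A0 R" if "X \<in> insert A0 R" "Y \<subseteq> X" for X Y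
        using min down that by blast
      then have "?Q (insert A0 R)" using R n A0(1) A(1) by blast
      then show False using max[of "insert A0 R"] A0 by blast
    qed
    moreover have "A0 \<noteq> {}" using A0 \<open>{} \<in> R\<close> by auto
    moreover have "ptree k R (?V - ?V)" using \<open>{} \<in> R\<close> by (auto intro: ptree.leaf)
    ultimately have "ptree k R (?V - A0)"
      using ptree_new_leaf[of k A0 R ?V] A0(1) A(1) R by blast
    then show ?thesis using A0(1) by blast
  qed
  show thesis
  proof (rule that)
    fix A B assume AB: "A \<subseteq> ?V" "B \<subseteq> ?V" "A \<notin> R" "B \<notin> R"
    obtain A0 B0 where 0: "A0 \<subseteq> A" "B0 \<subseteq> B" "ptree k R (?V - A0)" "ptree k R (?V - B0)"
      using cut_off[OF AB(1,3)] cut_off[OF AB(2,4)] by blast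
    show "A \<inter> B \<noteq> {}"
    proof
      assume "A \<inter> B = {}"
      then have "A0 \<inter> B0 = {}" "A0 \<subseteq> ?V" "B0 \<subseteq> ?V" using 0 AB by blast+
      then show False using ptree_join[of R A0 B0 k] down 0 R by blast
    qed
  qed (use R in blast)+
qed


subsection \<open>The robber's escape\<close>

abbreviation tec_class :: "'v \<Rightarrow> 'v set" where
  "tec_class c \<equiv> {v \<in> verts G. three_edge_connected G c v}"

lemma searchable_imp_ptree:
  assumes "searchable G k k" and c: "c \<in> verts G"
  shows "ptree k {X. X \<subseteq> verts G \<and> card (X \<inter> tec_class c) \<le> k} (verts G)"
proof (rule ccontr)
  let ?V = "verts G" and ?C = "tec_class c"
  let ?S = "{X. X \<subseteq> verts G \<and> card (X \<inter> ?C) \<le> k}"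
  assume no: "\<not> ptree k ?S ?V"
  have down: "Y \<in> ?S" if "X \<in> ?S" "Y \<subseteq> X" for X Y
  proof -
    have "card (Y \<inter> ?C) \<le> card (X \<inter> ?C)" using that by (intro card_mono) auto
    then show ?thesis using that by auto
  qed
  have "?S \<subseteq> Pow ?V" "{} \<in> ?S" by auto
  from ptree_obstruction[OF this(1) down this(2) no]
  obtain S where S: "?S \<subseteq> S" "\<not> ptree k S ?V"
    and meet: "\<And>A B. A \<subseteq> ?V \<Longrightarrow> B \<subseteq> ?V \<Longrightarrow> A \<notin> S \<Longrightarrow> B \<notin> S \<Longrightarrow> A \<inter> B \<noteq> {}"
    by this auto
  define comp where "comp F u = {v. reachable_avoiding G F u v}" for F u
  have comp_V: "comp F u \<subseteq> ?V" for F u by (auto simp: comp_def reachable_avoiding_iff)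
  have comp_eq: "comp F v = comp F u" if "v \<in> comp F u" for F u v
  proof -
    have r: "reachable_avoiding G F u v" using that by (simp add: comp_def)
    show ?thesis using reachable_trans[OF r] reachable_trans[OF reachable_sym[OF r]]
      unfolding comp_def by blast
  qed
  have big: "\<exists>u\<in>?C. comp F u \<notin> S \<and> card (comp F u \<inter> ?C) > k" if "F \<subseteq> edges G" "card F \<le> k" for F
  proof -
    have "\<exists>u\<in>?V. comp F u \<notin> S"
    proof (rule ccontr)
      assume all: "\<not> ?thesis"
      have bd: "\<Union>(cut ` comp F ` ?V) \<subseteq> F" using cut_reachable_set by (auto simp: comp_def)
      have F: "finite F" using that(1) finite_edges finite_subset by blast
      have "card (cut (comp F u)) \<le> k" for u
        using card_mono[OF F cut_reachable_set[of F u]] that(2) by (simp add: comp_def)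
      then have "\<forall>Y\<in>comp F ` ?V. ptree k S Y" using all by (auto intro: ptree.leaf)
      moreover have "comp F u \<inter> comp F v = {}" if "comp F u \<noteq> comp F v" for u v
        using that comp_eq[of _ F u] comp_eq[of _ F v] by (metis disjoint_iff)
      then have "disjoint (comp F ` ?V)" by (auto simp: disjoint_def)
      moreover have "card (\<Union>(cut ` comp F ` ?V)) \<le> k"
        using card_mono[OF F bd] that(2) by simp
      ultimately have "ptree k S (\<Union>(comp F ` ?V))" by (intro ptree.node)
      moreover have "\<Union>(comp F ` ?V) = ?V" using comp_V reachable_refl by (auto simp: comp_def)
      ultimately show False using S(2) by simp
    qed
    then obtain u where u: "comp F u \<notin> S" by blast
    then have "comp F u \<notin> ?S" using S(1) by blast
    then have k: "card (comp F u \<inter> ?C) > k" using comp_V[of F u] by simp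
    then have "comp F u \<inter> ?C \<noteq> {}" by (metis card.empty not_less_zero)
    then obtain v where v: "v \<in> comp F u" "v \<in> ?C" by blast
    show ?thesis by (rule bexI[OF _ v(2)]) (simp only: comp_eq[OF v(1)] u k not_False_eq_True simp_thms)
  qed
  define pick where "pick F = (SOME u. u \<in> ?C \<and> comp F u \<notin> S \<and> card (comp F u \<inter> ?C) > k)" for F
  have pick: "pick F \<in> ?C" "comp F (pick F) \<notin> S" "card (comp F (pick F) \<inter> ?C) > k"
    if "F \<subseteq> edges G" "card F \<le> k" for F
    using someI_ex[of "\<lambda>u. u \<in> ?C \<and> comp F u \<notin> S \<and> card (comp F u \<inter> ?C) > k"] big[OF that]
    unfolding pick_def by blast+
  obtain \<sigma> where \<sigma>: "cop_strategy G k \<sigma>"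
    and win: "\<And>r. robber_play G \<sigma> r \<Longrightarrow> \<exists>i\<ge>1. caught G k (cops_at \<sigma> r i) (r i)"
    using assms(1) unfolding searchable_def by blast
  define h where "h = rec_nat [] (\<lambda>i hs. hs @ [pick (if i = 0 then {} else \<sigma> hs)])"
  define r where "r i = pick (if i = 0 then {} else \<sigma> (h i))" for i
  have h: "map r [0..<i] = h i" for i by (induction i) (auto simp: h_def r_def)
  then have r: "r i = pick (cops_at \<sigma> r i)" for i by (simp add: cops_at_def r_def)
  have F: "cops_at \<sigma> r i \<subseteq> edges G" "card (cops_at \<sigma> r i) \<le> k" for i
    using \<sigma> by (auto simp: cops_at_def cop_strategy_def)
  have rC: "r i \<in> ?C" and rS: "comp (cops_at \<sigma> r i) (r i) \<notin> S"
    and rk: "card (comp (cops_at \<sigma> r i) (r i) \<inter> ?C) > k" for i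
    using pick[OF F[of i]] unfolding r[symmetric] by blast+
  then have rV: "r i \<in> ?V" for i by blast
  have tec: "three_edge_connected G (r i) v \<longleftrightarrow> three_edge_connected G c v" if "v \<in> ?V" for i v
    using rC[of i] c that three_edge_connected_iff by auto
  have "robber_play G \<sigma> r"
    unfolding robber_play_def
  proof (intro conjI allI impI)
    fix i :: nat assume "i \<ge> 1"
    let ?F = "cops_at \<sigma> r (i - 1)" and ?F' = "cops_at \<sigma> r i"
    have "comp ?F (r (i - 1)) \<inter> comp ?F' (r i) \<noteq> {}"
      by (intro meet comp_V rS)
    then obtain x where x: "reachable_avoiding G ?F (r (i - 1)) x" "reachable_avoiding G ?F' (r i) x"
      unfolding comp_def by blast
    have "reachable_avoiding G (?F \<inter> ?F') (r (i - 1)) (r i)"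
      by (rule reachable_trans[OF reachable_mono[OF x(1)] reachable_mono[OF reachable_sym[OF x(2)]]]) auto
    then show "robber_move G ?F ?F' (r (i - 1)) (r i)"
      using tec[OF rV] rC[of i] by (simp add: robber_move_def)
  qed (rule rV)
  from win[OF this] obtain i where i: "caught G k (cops_at \<sigma> r i) (r i)" by blast
  have "{v \<in> ?V. three_edge_connected G (r i) v \<and> reachable_avoiding G (cops_at \<sigma> r i) (r i) v} =
      comp (cops_at \<sigma> r i) (r i) \<inter> ?C"
    using tec comp_V by (auto simp: comp_def)
  then show False using i rk[of i] by (simp add: caught_def)
qed


subsection \<open>Connected sets and components\<close>

definition connected_set :: "'v set \<Rightarrow> bool" where
  "connected_set W \<longleftrightarrow>
     (\<forall>A. A \<inter> W \<noteq> {} \<longrightarrow> W - A \<noteq> {} \<longrightarrow> (\<exists>e\<in>cut A. ends G e \<subseteq> W))"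

definition comp_in :: "'v set \<Rightarrow> 'v \<Rightarrow> 'v set" where
  "comp_in S z = {v. reachable_avoiding G {e \<in> edges G. \<not> ends G e \<subseteq> S} z v}"

lemma connected_setD:
  assumes "connected_set W" "x \<in> W" "x \<in> A" "y \<in> W" "y \<notin> A"
  obtains e where "e \<in> cut A" "ends G e \<subseteq> W"
  using assms unfolding connected_set_def by blast

lemma comp_in_verts: "comp_in S z \<subseteq> verts G"
  by (auto simp: comp_in_def reachable_avoiding_iff)

lemma comp_in_self: "z \<in> verts G \<Longrightarrow> z \<in> comp_in S z"
  by (simp add: comp_in_def reachable_refl)

lemma comp_in_eq: "v \<in> comp_in S z \<Longrightarrow> comp_in S v = comp_in S z"
proof -
  assume "v \<in> comp_in S z"
  then have r: "reachable_avoiding G {e \<in> edges G. \<not> ends G e \<subseteq> S} z v" by (simp add: comp_in_def)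
  show ?thesis
    using reachable_trans[OF r] reachable_trans[OF reachable_sym[OF r]] unfolding comp_in_def by blast
qed

lemma comp_in_subset:
  assumes "z \<in> S"
  shows "comp_in S z \<subseteq> S"
proof
  fix v assume "v \<in> comp_in S z"
  moreover have "cut S \<subseteq> {e \<in> edges G. \<not> ends G e \<subseteq> S}" by (auto elim!: cutE)
  ultimately show "v \<in> S" using assms unfolding comp_in_def reachable_avoiding_iff by blast
qed

lemma comp_in_mono: "S \<subseteq> S' \<Longrightarrow> comp_in S z \<subseteq> comp_in S' z"
proof
  fix v assume S: "S \<subseteq> S'" and "v \<in> comp_in S z"
  then have "reachable_avoiding G {e \<in> edges G. \<not> ends G e \<subseteq> S} z v" by (simp add: comp_in_def)
  from reachable_mono[OF this, of "{e \<in> edges G. \<not> ends G e \<subseteq> S'}"] S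
  show "v \<in> comp_in S' z" unfolding comp_in_def by blast
qed

lemma comp_in_edge:
  assumes "x \<in> comp_in S z" "e \<in> edges G" "ends G e = {x, y}" "x \<in> S" "y \<in> S"
  shows "y \<in> comp_in S z"
proof -
  have "reachable_avoiding G {e \<in> edges G. \<not> ends G e \<subseteq> S} x y"
    by (rule reachable_edge[OF assms(2,3)]) (use assms in simp)
  then show ?thesis using assms(1) reachable_trans unfolding comp_in_def by blast
qed

lemma cut_comp_in:
  assumes "z \<in> S"
  shows "cut (comp_in S z) \<subseteq> cut S"
proof
  fix e assume "e \<in> cut (comp_in S z)"
  then obtain x y where e: "e \<in> edges G" "ends G e = {x, y}" "x \<in> comp_in S z" "y \<notin> comp_in S z"
    by (elim cutE)
  then have "x \<in> S" "y \<notin> S" using comp_in_subset[OF assms] comp_in_edge[of x S z e y] by blast+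
  then show "e \<in> cut S" using in_cut_iff[OF e(1,2)] by simp
qed

lemma connected_comp_in:
  assumes "z \<in> S"
  shows "connected_set (comp_in S z)"
  unfolding connected_set_def
proof (intro allI impI)
  let ?K = "comp_in S z"
  fix A assume "A \<inter> ?K \<noteq> {}" "?K - A \<noteq> {}"
  then obtain x y where xy: "x \<in> A" "x \<in> ?K" "y \<in> ?K" "y \<notin> A" by blast
  have "y \<in> comp_in S x" using comp_in_eq[OF xy(2)] xy(3) by simp
  then have "reachable_avoiding G {e \<in> edges G. \<not> ends G e \<subseteq> S} x y"
    by (simp add: comp_in_def)
  from reachable_closed[OF this, of "A \<inter> ?K"]
  have "\<not> cut (A \<inter> ?K) \<subseteq> {e \<in> edges G. \<not> ends G e \<subseteq> S}" using xy by auto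
  then obtain e where e: "e \<in> cut (A \<inter> ?K)" "ends G e \<subseteq> S" using cut_subset by blast
  from e(1) obtain u v where uv: "e \<in> edges G" "ends G e = {u, v}" "u \<in> A \<inter> ?K" "v \<notin> A \<inter> ?K"
    by (elim cutE)
  then have "v \<in> ?K" using comp_in_edge[of u S z e v] e(2) by simp
  then have "e \<in> cut A" "ends G e \<subseteq> ?K" using uv in_cut_iff[OF uv(1,2)] by auto
  then show "\<exists>e\<in>cut A. ends G e \<subseteq> ?K" by blast
qed

lemma connected_Un:
  assumes "connected_set W" "connected_set W'" "e \<in> edges G" "ends G e = {x, y}" "x \<in> W" "y \<in> W'"
  shows "connected_set (W \<union> W')"
  unfolding connected_set_def
proof (intro allI impI)
  fix A assume A: "A \<inter> (W \<union> W') \<noteq> {}" "W \<union> W' - A \<noteq> {}"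
  then consider "A \<inter> W \<noteq> {}" "W - A \<noteq> {}" | "A \<inter> W' \<noteq> {}" "W' - A \<noteq> {}"
    | "W \<subseteq> A" "A \<inter> W' = {}" | "A \<inter> W = {}" "W' \<subseteq> A" by auto
  then show "\<exists>e\<in>cut A. ends G e \<subseteq> W \<union> W'"
  proof cases
    case 1
    then obtain f where "f \<in> cut A" "ends G f \<subseteq> W" using assms(1) unfolding connected_set_def by blast
    then show ?thesis by blast
  next
    case 2
    then obtain f where "f \<in> cut A" "ends G f \<subseteq> W'" using assms(2) unfolding connected_set_def by blast
    then show ?thesis by blast
  next
    case 3
    then have "e \<in> cut A" using in_cut_iff[OF assms(3,4), of A] assms(5,6) by auto
    moreover have "ends G e \<subseteq> W \<union> W'" using assms(4-6) by simp
    ultimately show ?thesis by blast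
  next
    case 4
    then have "e \<in> cut A" using in_cut_iff[OF assms(3,4), of A] assms(5,6) by auto
    moreover have "ends G e \<subseteq> W \<union> W'" using assms(4-6) by simp
    ultimately show ?thesis by blast
  qed
qed

lemma cut_submodular:
  "card (cut (A \<inter> B)) + card (cut (A \<union> B)) \<le> card (cut A) + card (cut B)"
proof -
  have "cut (A \<inter> B) \<union> cut (A \<union> B) \<subseteq> cut A \<union> cut B" "cut (A \<inter> B) \<inter> cut (A \<union> B) \<subseteq> cut A \<inter> cut B"
    by (auto simp: cut_def)
  then have "card (cut (A \<inter> B) \<union> cut (A \<union> B)) \<le> card (cut A \<union> cut B)"
    "card (cut (A \<inter> B) \<inter> cut (A \<union> B)) \<le> card (cut A \<inter> cut B)"
    by (simp_all add: card_mono)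
  then show ?thesis
    using card_Un_Int[of "cut (A \<inter> B)" "cut (A \<union> B)"] card_Un_Int[of "cut A" "cut B"] by simp
qed

lemma cut_submodular_strict:
  assumes "e \<in> cut A" "e \<in> cut B" "e \<notin> cut (A \<inter> B)" "e \<notin> cut (A \<union> B)"
  shows "card (cut (A \<inter> B)) + card (cut (A \<union> B)) + 2 \<le> card (cut A) + card (cut B)"
proof -
  have "cut (A \<inter> B) \<union> cut (A \<union> B) \<subseteq> (cut A \<union> cut B) - {e}"
    "cut (A \<inter> B) \<inter> cut (A \<union> B) \<subseteq> (cut A \<inter> cut B) - {e}"
    using assms(3,4) by (auto simp: cut_def)
  then have "card (cut (A \<inter> B) \<union> cut (A \<union> B)) \<le> card ((cut A \<union> cut B) - {e})"
    "card (cut (A \<inter> B) \<inter> cut (A \<union> B)) \<le> card ((cut A \<inter> cut B) - {e})"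
    by (simp_all add: card_mono)
  moreover have "card ((cut A \<union> cut B) - {e}) < card (cut A \<union> cut B)"
    by (rule card_Diff1_less) (use assms in auto)
  moreover have "card ((cut A \<inter> cut B) - {e}) < card (cut A \<inter> cut B)"
    by (rule card_Diff1_less) (use assms in auto)
  ultimately show ?thesis
    using card_Un_Int[of "cut (A \<inter> B)" "cut (A \<union> B)"] card_Un_Int[of "cut A" "cut B"] by simp
qed

text \<open>Without connectedness of \<open>W\<close> this fails: \<open>W\<close> may consist of a pendant vertex of \<open>W'\<close>
  and a second pendant vertex elsewhere.\<close>

lemma thin_Un:
  assumes thin: "card (cut W) \<le> 2" "card (cut W') \<le> 2" and "connected_set W"
    and e: "e \<in> edges G" "ends G e = {x, y}" "x \<in> W" "y \<in> W'" "y \<notin> W"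
  shows "card (cut (W \<union> W')) \<le> 2"
proof (rule ccontr)
  assume n: "\<not> ?thesis"
  note e_iff = in_cut_iff[OF e(1,2)]
  have x: "x \<in> W'"
  proof (rule ccontr)
    assume "x \<notin> W'"
    then have "e \<in> cut W" "e \<in> cut W'" "e \<notin> cut (W \<inter> W')" "e \<notin> cut (W \<union> W')"
      using e e_iff by auto
    then show False using cut_submodular_strict[of e W W'] thin n by simp
  qed
  have "card (cut (W \<inter> W')) \<le> 1" using cut_submodular[of W W'] thin n by simp
  moreover have ec: "e \<in> cut (W \<inter> W')" using e e_iff x by simp
  ultimately have only: "f = e" if "f \<in> cut (W \<inter> W')" for f
    using that card_le_Suc0_iff_eq[of "cut (W \<inter> W')"] by simp
  have "W \<subseteq> W'"
  proof (rule ccontr)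
    assume "\<not> W \<subseteq> W'"
    then obtain w where "w \<in> W" "w \<notin> W'" by blast
    with assms(3) e(3) x obtain f where f: "f \<in> cut W'" "ends G f \<subseteq> W" by (elim connected_setD)
    then have "f \<in> cut (W \<inter> W')" using src_tgt(1)[of f] by (auto simp: cut_def)
    then have "f = e" by (rule only)
    then show False using f(2) e by simp
  qed
  then have "W \<union> W' = W'" by blast
  then show False using n thin by simp
qed


subsection \<open>Three-edge-connected classes\<close>

lemma tec_class_self: "c \<in> verts G \<Longrightarrow> c \<in> tec_class c"
  by (simp add: three_edge_connected_def)

lemma tec_class_thin:
  assumes "c \<in> verts G" "card (cut A) \<le> 2" "x \<in> tec_class c" "y \<in> tec_class c"
  shows "x \<in> A \<longleftrightarrow> y \<in> A"
  using assms three_edge_connected_iff[OF assms(1)] by blast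

lemma not_tec_separated:
  assumes "c \<in> verts G" "z \<in> verts G" "z \<notin> tec_class c"
  obtains A where "card (cut A) \<le> 2" "z \<in> A" "A \<inter> tec_class c = {}"
proof -
  obtain A where A: "card (cut A) \<le> 2" "(c \<in> A) \<noteq> (z \<in> A)"
    using assms three_edge_connected_iff[OF assms(1,2)] by blast
  have *: "x \<in> A \<longleftrightarrow> c \<in> A" if "x \<in> tec_class c" for x
    using tec_class_thin[OF assms(1) A(1) that tec_class_self[OF assms(1)]] .
  show thesis
  proof (cases "z \<in> A")
    case True
    then show thesis using A * by (intro that[of A]) blast+
  next
    case False
    then show thesis using A * by (intro that[of "- A"]) (auto simp: cut_compl)
  qed
qed

abbreviation lobe :: "'v \<Rightarrow> 'v \<Rightarrow> 'v set" where
  "lobe c z \<equiv> comp_in (verts G - tec_class c) z"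

lemma lobe_thin:
  assumes c: "c \<in> verts G" and z: "z \<in> verts G" "z \<notin> tec_class c"
  shows "card (cut (lobe c z)) \<le> 2"
proof -
  let ?C = "tec_class c" and ?K = "lobe c z"
  have ex: "\<exists>W. y \<in> W \<and> W \<subseteq> lobe c y \<and> connected_set W \<and> card (cut W) \<le> 2"
    if y: "y \<in> verts G" "y \<notin> ?C" for y
  proof -
    obtain A where A: "card (cut A) \<le> 2" "y \<in> A" "A \<inter> ?C = {}"
      using not_tec_separated[OF c y] .
    let ?W = "comp_in (A \<inter> verts G) y"
    have yA: "y \<in> A \<inter> verts G" using A y by simp
    have "cut ?W \<subseteq> cut A" using cut_comp_in[OF yA] cut_verts by simp
    then have "card (cut ?W) \<le> 2" using A(1) card_mono[OF finite_cut, of "cut ?W" A] by simp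
    moreover have "?W \<subseteq> lobe c y" by (rule comp_in_mono) (use A(3) in blast)
    ultimately show ?thesis using connected_comp_in[OF yA] comp_in_self[OF y(1)] by blast
  qed
  define good where "good W \<longleftrightarrow> z \<in> W \<and> W \<subseteq> ?K \<and> connected_set W \<and> card (cut W) \<le> 2" for W
  have "finite ?K" by (rule finite_subset[OF comp_in_verts]) simp
  then have "finite {W. good W}" by (rule finite_subset[rotated, OF finite_Pow_iff[THEN iffD2]]) (auto simp: good_def)
  moreover obtain W0 where "good W0" using ex[OF z] by (auto simp: good_def)
  ultimately obtain W where "W \<in> {W. good W}" and max': "\<forall>W'\<in>{W. good W}. W \<subseteq> W' \<longrightarrow> W = W'"
    using finite_has_maximal[of "{W. good W}"] by (metis (no_types, lifting) empty_iff mem_Collect_eq)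
  then have W: "good W" "z \<in> W" "W \<subseteq> ?K" "connected_set W" "card (cut W) \<le> 2"
    and max: "\<And>W'. good W' \<Longrightarrow> W \<subseteq> W' \<Longrightarrow> W = W'" by (auto simp: good_def)
  have zS: "z \<in> verts G - ?C" using z by simp
  have "W = ?K"
  proof (rule ccontr)
    assume "W \<noteq> ?K"
    then obtain y0 where y0: "y0 \<in> ?K" "y0 \<notin> W" using W(3) by blast
    have "z \<in> ?K" using W(2,3) by blast
    with connected_comp_in[OF zS] obtain e where e: "e \<in> cut W" "ends G e \<subseteq> ?K"
      using W(2) y0 by (elim connected_setD)
    from e(1) obtain x y where xy: "e \<in> edges G" "ends G e = {x, y}" "x \<in> W" "y \<notin> W" "y \<in> verts G"
      by (elim cutE)
    have yK: "y \<in> ?K" using e(2) xy(2) by simp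
    then have "y \<notin> ?C" using comp_in_subset[OF zS] by blast
    then obtain W' where W': "y \<in> W'" "W' \<subseteq> lobe c y" "connected_set W'" "card (cut W') \<le> 2"
      using ex[OF xy(5)] by blast
    have "W' \<subseteq> ?K" using W'(2) comp_in_eq[OF yK] by simp
    then have "good (W \<union> W')"
      using W W' thin_Un[OF W(5) W'(4) W(4) xy(1-3) W'(1) xy(4)]
        connected_Un[OF W(4) W'(3) xy(1-3) W'(1)] by (simp add: good_def)
    then show False using max[of "W \<union> W'"] W'(1) xy(4) by blast
  qed
  then show ?thesis using W(5) by simp
qed

lemma lobe_props:
  assumes "z \<in> verts G" "z \<notin> tec_class c"
  shows "z \<in> lobe c z" "lobe c z \<subseteq> verts G" "lobe c z \<inter> tec_class c = {}" "connected_set (lobe c z)"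
    "\<And>v. v \<in> lobe c z \<Longrightarrow> lobe c v = lobe c z"
  using assms comp_in_self[of z] comp_in_verts comp_in_subset[of z "verts G - tec_class c"]
    connected_comp_in[of z "verts G - tec_class c"] comp_in_eq by blast+

lemma lobe_edge:
  assumes "z \<in> verts G" "z \<notin> tec_class c" "e \<in> edges G" "ends G e = {x, y}" "x \<in> lobe c z"
  shows "y \<in> lobe c z \<or> y \<in> tec_class c"
proof -
  have "x \<in> verts G - tec_class c" using lobe_props[OF assms(1,2)] assms(5) by blast
  then show ?thesis using comp_in_edge[OF assms(5,3,4)] ends_cases(3)[OF assms(3,4)] by blast
qed

lemma cut_lobeE:
  assumes "z \<in> verts G" "z \<notin> tec_class c" "e \<in> cut (lobe c z)"
  obtains x y where "e \<in> edges G" "ends G e = {x, y}" "x \<in> lobe c z" "y \<in> tec_class c"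
    "x \<notin> tec_class c" "y \<notin> lobe c z"
proof -
  from assms(3) obtain x y where xy: "e \<in> edges G" "ends G e = {x, y}" "x \<in> lobe c z" "y \<notin> lobe c z"
    by (elim cutE)
  then have "y \<in> tec_class c" using lobe_edge[OF assms(1,2)] by blast
  moreover have "x \<notin> tec_class c" using lobe_props(3)[OF assms(1,2)] xy(3) by blast
  ultimately show thesis using that xy by blast
qed

text \<open>Pulling back along a retraction does not enlarge borders: a lobe contributes a new border edge
  only if it joins two sides, and then some edge at the lobe was already in the border.\<close>

definition retraction :: "'v \<Rightarrow> ('v \<Rightarrow> 'v) \<Rightarrow> bool" where
  "retraction c \<phi> \<longleftrightarrow> (\<forall>v\<in>tec_class c. \<phi> v = v) \<and>
     (\<forall>v\<in>verts G - tec_class c. \<phi> v \<in> tec_class c \<and> (\<forall>w\<in>lobe c v. \<phi> w = \<phi> v) \<and>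
        (cut (lobe c v) = {} \<or> (\<exists>e\<in>cut (lobe c v). \<phi> v \<in> ends G e)))"

definition pull :: "('v \<Rightarrow> 'v) \<Rightarrow> 'v set \<Rightarrow> 'v set" where
  "pull \<phi> A = {v \<in> verts G. \<phi> v \<in> A}"

lemma in_cut_pull:
  assumes "e \<in> edges G" "ends G e = {x, y}"
  shows "e \<in> cut (pull \<phi> A) \<longleftrightarrow> (\<phi> x \<in> A) \<noteq> (\<phi> y \<in> A)"
  using in_cut_iff[OF assms] ends_cases[OF assms] by (simp add: pull_def)

lemma retraction_border:
  assumes c: "c \<in> verts G" and \<phi>: "retraction c \<phi>"
  shows "card (\<Union>Y\<in>P. cut (pull \<phi> Y)) \<le> card (\<Union>Y\<in>P. cut Y)"
proof -
  let ?C = "tec_class c" and ?N = "\<Union>Y\<in>P. cut Y" and ?N' = "\<Union>Y\<in>P. cut (pull \<phi> Y)"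
  have fC: "\<phi> v = v" if "v \<in> ?C" for v using \<phi> that unfolding retraction_def by blast
  have fL: "\<phi> w = \<phi> z" if "z \<in> verts G" "z \<notin> ?C" "w \<in> lobe c z" for z w
    using \<phi> that unfolding retraction_def by blast
  define R where "R e f \<longleftrightarrow> (ends G e \<subseteq> ?C \<and> f = e) \<or>
    (\<exists>z\<in>verts G. z \<in> ends G e \<and> z \<notin> ?C \<and> e \<in> cut (lobe c z) \<and> ends G f \<inter> lobe c z \<noteq> {})" for e f
  have lobe_case: "\<exists>x e1. x \<in> ?C \<and> ends G e = {z, x} \<and> x \<noteq> \<phi> z \<and> e \<in> cut (lobe c z) \<and>
      e1 \<in> cut (lobe c z) \<and> \<phi> z \<in> ends G e1 \<and> \<phi> z \<in> ?C"
    if e: "e \<in> ?N'" and z: "z \<in> ends G e" "z \<notin> ?C" for e z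
  proof -
    obtain Y where Y: "e \<in> cut (pull \<phi> Y)" using e by blast
    then have E: "e \<in> edges G" using cut_subset by blast
    then obtain x where x: "ends G e = {z, x}" using src_tgt(1)[OF E] z(1) by auto
    have zV: "z \<in> verts G" using ends_cases(2)[OF E x] .
    have neq: "\<phi> z \<noteq> \<phi> x" using in_cut_pull[OF E x] Y by auto
    then have "x \<notin> lobe c z" using fL[OF zV z(2), of x] by auto
    then have "x \<in> ?C" using lobe_edge[OF zV z(2) E x] lobe_props(1)[OF zV z(2)] by blast
    moreover have ec: "e \<in> cut (lobe c z)"
      using in_cut_iff[OF E x] \<open>x \<notin> lobe c z\<close> lobe_props(1)[OF zV z(2)] by simp
    moreover obtain e1 where "e1 \<in> cut (lobe c z)" "\<phi> z \<in> ends G e1" "\<phi> z \<in> ?C"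
      using \<phi> zV z(2) ec unfolding retraction_def by blast
    moreover have "x \<noteq> \<phi> z" using neq fC[OF \<open>x \<in> ?C\<close>] by simp
    ultimately show ?thesis using x by blast
  qed
  have "\<exists>f\<in>?N. R e f" if e: "e \<in> ?N'" for e
  proof (cases "ends G e \<subseteq> ?C")
    case True
    obtain Y where Y: "Y \<in> P" "e \<in> cut (pull \<phi> Y)" using e by blast
    then have E: "e \<in> edges G" using cut_subset by blast
    have "e \<in> cut Y"
      using in_cut_pull[OF E src_tgt(1)[OF E], of \<phi> Y] Y(2) True src_tgt(1)[OF E] fC E
      by (auto simp: cut_def)
    then show ?thesis using Y(1) True unfolding R_def by blast
  next
    case False
    then obtain z where z: "z \<in> ends G e" "z \<notin> ?C" by blast
    obtain x e1 where xe: "x \<in> ?C" "ends G e = {z, x}" "x \<noteq> \<phi> z" "e \<in> cut (lobe c z)"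
      "e1 \<in> cut (lobe c z)" "\<phi> z \<in> ends G e1" "\<phi> z \<in> ?C" using lobe_case[OF e z] by blast
    obtain Y where Y: "Y \<in> P" "e \<in> cut (pull \<phi> Y)" using e by blast
    then have E: "e \<in> edges G" using cut_subset by blast
    have zV: "z \<in> verts G" using ends_cases(2)[OF E xe(2)] .
    note K = lobe_props[OF zV z(2)]
    obtain w u where wu: "e1 \<in> edges G" "ends G e1 = {w, u}" "w \<in> lobe c z" "u \<in> ?C"
      "w \<notin> ?C" "u \<notin> lobe c z"
      by (rule cut_lobeE[OF zV z(2) xe(5)])
    then have u: "u = \<phi> z" using xe(6,7) by auto
    have sep: "(x \<in> Y) \<noteq> (\<phi> z \<in> Y)" using in_cut_pull[OF E xe(2)] Y(2) fC[OF xe(1)] by auto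
    have "\<exists>f\<in>cut Y. ends G f \<inter> lobe c z \<noteq> {}"
    proof (rule ccontr)
      assume none: "\<not> ?thesis"
      have "e \<notin> cut Y" "e1 \<notin> cut Y" using none xe(2) K(1) wu(2,3) by blast+
      then have "(w \<in> Y) \<noteq> (z \<in> Y)"
        using sep in_cut_iff[OF E xe(2)] in_cut_iff[OF wu(1,2)] u by blast
      then have "Y \<inter> lobe c z \<noteq> {}" "lobe c z - Y \<noteq> {}" using wu(3) K(1) by blast+
      then obtain f where f: "f \<in> cut Y" "ends G f \<subseteq> lobe c z"
        using K(4) unfolding connected_set_def by blast
      moreover have "ends G f \<noteq> {}" using src_tgt(1)[of f] f(1) cut_subset by blast
      ultimately show False using none by blast
    qed
    then show ?thesis using Y(1) z zV xe(4) unfolding R_def by blast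
  qed
  then have "\<forall>e\<in>?N'. \<exists>f. f \<in> ?N \<and> R e f" by blast
  from bchoice[OF this] obtain g where g: "\<And>e. e \<in> ?N' \<Longrightarrow> g e \<in> ?N \<and> R e (g e)" by blast
  have inj: "e = e'" if e: "e \<in> ?N'" "e' \<in> ?N'" and f: "f \<in> edges G" "R e f" "R e' f" for e e' f
  proof -
    have not_both: False if "ends G f \<subseteq> ?C" "ends G f \<inter> lobe c z \<noteq> {}" "z \<in> verts G" "z \<notin> ?C" for z
      using lobe_props(3)[OF that(3,4)] that(1,2) by blast
    have R_class: "ends G f \<subseteq> ?C \<Longrightarrow> f = a" and R_lobe: "\<not> ends G f \<subseteq> ?C \<Longrightarrow>
        \<exists>z\<in>verts G. z \<in> ends G a \<and> z \<notin> ?C \<and> ends G f \<inter> lobe c z \<noteq> {}" if "R a f" for a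
      using that not_both unfolding R_def by blast+
    show ?thesis
    proof (cases "ends G f \<subseteq> ?C")
      case True
      then show ?thesis using R_class[OF f(2)] R_class[OF f(3)] by simp
    next
      case False
      obtain z where z: "z \<in> verts G" "z \<in> ends G e" "z \<notin> ?C" "ends G f \<inter> lobe c z \<noteq> {}"
        using R_lobe[OF f(2) False] by blast
      obtain z' where z': "z' \<in> verts G" "z' \<in> ends G e'" "z' \<notin> ?C" "ends G f \<inter> lobe c z' \<noteq> {}"
        using R_lobe[OF f(3) False] by blast
      note 2 = z z'
      note K = lobe_props[OF 2(1,3)] and K' = lobe_props[OF 2(5,7)]
      have "lobe c z = lobe c z'"
      proof -
        obtain p q where pq: "p \<in> ends G f" "p \<in> lobe c z" "q \<in> ends G f" "q \<in> lobe c z'" using 2 by blast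
        have "q \<notin> ?C" using K'(3) pq(4) by blast
        moreover have "p = q \<or> ends G f = {p, q}" using src_tgt(1)[OF f(1)] pq(1,3) by auto
        ultimately have "q \<in> lobe c z" using lobe_edge[OF 2(1,3) f(1) _ pq(2)] pq(2) by blast
        then show ?thesis using K(5) K'(5)[OF pq(4)] by simp
      qed
      obtain x e1 where xe: "x \<in> ?C" "ends G e = {z, x}" "x \<noteq> \<phi> z" "e \<in> cut (lobe c z)"
        "e1 \<in> cut (lobe c z)" "\<phi> z \<in> ends G e1" "\<phi> z \<in> ?C" using lobe_case[OF e(1) 2(2,3)] by blast
      obtain x' where xe': "x' \<in> ?C" "ends G e' = {z', x'}" "x' \<noteq> \<phi> z'" "e' \<in> cut (lobe c z')"
        using lobe_case[OF e(2) 2(6,7)] by blast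
      have "\<phi> z' = \<phi> z" using fL[OF 2(1,3)] K'(1) \<open>lobe c z = lobe c z'\<close> by simp
      then have "\<phi> z \<notin> ends G e" "\<phi> z \<notin> ends G e'" using xe xe' 2(3,7) by auto
      then have "e1 \<noteq> e" "e1 \<noteq> e'" using xe(6) by auto
      moreover have "{e, e', e1} \<subseteq> cut (lobe c z)" using xe xe' \<open>lobe c z = lobe c z'\<close> by simp
      then have "card {e, e', e1} \<le> 2"
        using card_mono[OF finite_cut] lobe_thin[OF c 2(1,3)] by (meson order_trans)
      ultimately show ?thesis by (cases "e = e'") auto
    qed
  qed
  have "inj_on g ?N'"
  proof (rule inj_onI)
    fix e e' assume e: "e \<in> ?N'" "e' \<in> ?N'" "g e = g e'"
    have "g e \<in> edges G" using g[OF e(1)] cut_subset by blast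
    then show "e = e'" using inj[OF e(1,2), of "g e"] g[OF e(1)] g[OF e(2)] e(3) by simp
  qed
  moreover have "g ` ?N' \<subseteq> ?N" using g by blast
  ultimately show ?thesis by (rule card_inj_on_le[OF _ _ finite_border])
qed


subsection \<open>Rooted decompositions\<close>

text \<open>A set \<open>B\<close> is decomposable if it is the union of the bags of a subtree of a tree-cut
  decomposition of small width, where the rest of the graph lies beyond the root.\<close>

inductive tcdec :: "nat \<Rightarrow> 'v set \<Rightarrow> bool" for k where
  intro: "X \<subseteq> verts G \<Longrightarrow> card X \<le> k \<Longrightarrow> X \<inter> \<Union>P = {} \<Longrightarrow> disjoint P \<Longrightarrow> \<forall>Y\<in>P. tcdec k Y \<Longrightarrow>
    card (\<Union>(cut ` {Y \<in> insert (X \<union> \<Union>P) P. card (cut Y) \<ge> 3})) \<le> k \<Longrightarrow> tcdec k (X \<union> \<Union>P)"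

lemma card_thick_border:
  assumes "{Y \<in> Q. card (cut Y) \<ge> 3} \<subseteq> {Z}" "card (cut Z) \<le> k"
  shows "card (\<Union>(cut ` {Y \<in> Q. card (cut Y) \<ge> 3})) \<le> k"
proof -
  have "\<Union>(cut ` {Y \<in> Q. card (cut Y) \<ge> 3}) \<subseteq> cut Z" using assms(1) by blast
  then show ?thesis using card_mono[OF finite_cut] assms(2) by (meson order_trans)
qed

lemma ptree_imp_tcdec:
  assumes "ptree k {X. X \<subseteq> verts G \<and> card (X \<inter> tec_class c) \<le> k} X"
    and c: "c \<in> verts G" and \<phi>: "retraction c \<phi>"
    and lobes: "\<And>v. v \<in> B - tec_class c \<Longrightarrow> v \<in> verts G \<Longrightarrow> tcdec k (lobe c v)"
    and "pull \<phi> X \<subseteq> B"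
  shows "tcdec k (pull \<phi> X)"
  using assms(1,5)
proof (induction rule: ptree.induct)
  case (leaf X)
  let ?C = "tec_class c" and ?L = "pull \<phi> X"
  let ?P = "lobe c ` (?L - ?C)"
  have LV: "?L \<subseteq> verts G" by (auto simp: pull_def)
  have LC: "?L \<inter> ?C = X \<inter> ?C" using \<phi> by (auto simp: retraction_def pull_def)
  have sub: "lobe c v \<subseteq> ?L - ?C" "v \<in> lobe c v" if v: "v \<in> ?L - ?C" for v
  proof -
    have vV: "v \<in> verts G" "v \<notin> ?C" using v LV by blast+
    note K = lobe_props[OF vV]
    have "\<phi> w = \<phi> v" if "w \<in> lobe c v" for w
      using \<phi> vV that unfolding retraction_def by blast
    then have "lobe c v \<subseteq> ?L" using K(2) v by (auto simp: pull_def)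
    then show "lobe c v \<subseteq> ?L - ?C" "v \<in> lobe c v" using K(1,3) by blast+
  qed
  then have UP: "\<Union>?P = ?L - ?C" by blast
  have "tcdec k (?L \<inter> ?C \<union> \<Union>?P)"
  proof (rule tcdec.intro)
    show "card (?L \<inter> ?C) \<le> k" using leaf(1) LC by simp
    show "?L \<inter> ?C \<inter> \<Union>?P = {}" using UP by blast
    have "lobe c u \<inter> lobe c v = {}" if "lobe c u \<noteq> lobe c v" for u v
      using that comp_in_eq by (metis disjoint_iff)
    then show "disjoint ?P" by (auto simp: disjoint_def)
    show "\<forall>Y\<in>?P. tcdec k Y" using lobes leaf.prems LV by blast
    have "card (cut Y) \<le> 2" if "Y \<in> ?P" for Y using that lobe_thin[OF c] LV by blast
    then have "{Y \<in> insert (?L \<inter> ?C \<union> \<Union>?P) ?P. card (cut Y) \<ge> 3} \<subseteq> {?L}"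
      using UP by fastforce
    moreover have "card (cut ?L) \<le> k" using retraction_border[OF c \<phi>, of "{X}"] leaf(2) by simp
    ultimately show "card (\<Union>(cut ` {Y \<in> insert (?L \<inter> ?C \<union> \<Union>?P) ?P. card (cut Y) \<ge> 3})) \<le> k"
      by (rule card_thick_border)
  qed auto
  moreover have "?L \<inter> ?C \<union> \<Union>?P = ?L" using UP by blast
  ultimately show ?case by simp
next
  case (node P)
  let ?P = "pull \<phi> ` P"
  have UP: "\<Union>?P = pull \<phi> (\<Union>P)" by (auto simp: pull_def)
  have "tcdec k ({} \<union> \<Union>?P)"
  proof (rule tcdec.intro)
    have "pull \<phi> Y \<inter> pull \<phi> Z = {}" if "Y \<in> P" "Z \<in> P" "pull \<phi> Y \<noteq> pull \<phi> Z" for Y Z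
    proof -
      have "Y \<noteq> Z" using that(3) by blast
      then have "Y \<inter> Z = {}" using node(2) that(1,2) by (simp add: disjoint_def)
      then show ?thesis by (auto simp: pull_def)
    qed
    then show "disjoint ?P" by (auto simp: disjoint_def)
    have "pull \<phi> Y \<subseteq> B" if "Y \<in> P" for Y using node.prems UP that by blast
    then show "\<forall>Y\<in>?P. tcdec k Y" using node(1) by blast
    have "\<Union>(cut ` {Y \<in> insert ({} \<union> \<Union>?P) ?P. card (cut Y) \<ge> 3}) \<subseteq> \<Union>(cut ` ?P)"
      using cut_Union_subset[of ?P] by auto
    then have "card (\<Union>(cut ` {Y \<in> insert ({} \<union> \<Union>?P) ?P. card (cut Y) \<ge> 3})) \<le> card (\<Union>(cut ` ?P))"
      by (rule card_mono[OF finite_border])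
    also have "\<dots> \<le> card (\<Union>(cut ` P))" using retraction_border[OF c \<phi>, of P] by (simp add: image_image)
    also have "\<dots> \<le> k" by (rule node(3))
    finally show "card (\<Union>(cut ` {Y \<in> insert ({} \<union> \<Union>?P) ?P. card (cut Y) \<ge> 3})) \<le> k" .
  qed auto
  then show ?case using UP by simp
qed

text \<open>If the border of \<open>B\<close> consists of two bridges, the two parts of the rest of the graph may have
  to be attached at different nodes, so that no rooted decomposition of \<open>B\<close> of small width exists.\<close>

definition tight :: "'v set \<Rightarrow> bool" where
  "tight B \<longleftrightarrow> card (cut B) \<le> 2 \<and> (card (cut B) = 2 \<longrightarrow> (\<forall>R. \<forall>e\<in>cut B. cut R \<noteq> {e}))"

lemma cut_sym_diff: "cut (sym_diff A B) = sym_diff (cut A) (cut B)"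
  by (auto simp: cut_def)

lemma tight_split:
  assumes B: "tight B" "B \<subseteq> verts G" and e: "e \<in> edges G" "ends G e = {a, b}" "b \<in> B" "a \<notin> B"
    and e': "e' \<in> edges G" "ends G e' = {a', b'}" "b' \<in> B" "a' \<notin> B"
    and Y: "card (cut Y) \<le> 2" "b \<in> Y" "b' \<notin> Y"
  shows "tight (B \<inter> Y) \<and> tight (B - Y)"
proof -
  note iff = in_cut_iff[OF e(1,2)] in_cut_iff[OF e'(1,2)]
  have ee': "e \<noteq> e'"
  proof
    assume "e = e'"
    then have "{a, b} = {a', b'}" using e(2) e'(2) by simp
    then show False using e(3,4) e'(3,4) Y(2,3) by (auto simp: doubleton_eq_iff)
  qed
  have in_cutB: "e \<in> cut B" "e' \<in> cut B" using iff e e' by auto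
  have cutB: "cut B = {e, e'}" "card (cut B) = 2"
  proof -
    have "{e, e'} \<subseteq> cut B" "card (cut B) \<le> card {e, e'}" using in_cutB ee' B(1) by (auto simp: tight_def)
    then show "cut B = {e, e'}" using card_seteq[of "cut B" "{e, e'}"] by auto
    then show "card (cut B) = 2" using ee' by simp
  qed
  have no_bridge: "cut R \<noteq> {e}" "cut R \<noteq> {e'}" for R using B(1) cutB by (auto simp: tight_def)
  define M where "M = {f \<in> cut Y. ends G f \<subseteq> B}"
  have M: "e \<notin> M" "e' \<notin> M" using e e' by (auto simp: M_def)
  have inner: "f = e \<or> f = e' \<or> ends G f \<inter> B = {} \<or> ends G f \<subseteq> B" if "f \<in> edges G" for f
  proof -
    have "f \<notin> cut B \<or> f = e \<or> f = e'" using cutB(1) by blast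
    then show ?thesis using that src_tgt(1)[OF that] by (auto simp: cut_def)
  qed
  have other: "f \<in> cut (B \<inter> Y) \<longleftrightarrow> f \<in> M" "f \<in> cut (B - Y) \<longleftrightarrow> f \<in> M" if "f \<noteq> e" "f \<noteq> e'" for f
    using inner[of f] that src_tgt(1)[of f] by (auto simp: cut_def M_def)
  have "e \<in> cut (B \<inter> Y)" "e' \<notin> cut (B \<inter> Y)" "e \<notin> cut (B - Y)" "e' \<in> cut (B - Y)"
    using iff e e' Y(2,3) by auto
  then have "f \<in> cut (B \<inter> Y) \<longleftrightarrow> f \<in> insert e M" "f \<in> cut (B - Y) \<longleftrightarrow> f \<in> insert e' M" for f
    using other[of f] M by (cases "f = e"; cases "f = e'"; simp add: ee')+
  then have cuts: "cut (B \<inter> Y) = insert e M" "cut (B - Y) = insert e' M" by blast+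
  have finM: "finite M" by (rule finite_subset[of _ "cut Y"]) (auto simp: M_def)
  have "card M \<le> 1"
  proof (rule ccontr)
    assume "\<not> ?thesis"
    then have "M = cut Y" using Y(1) by (intro card_seteq) (auto simp: M_def)
    then have "cut (sym_diff (B \<inter> Y) Y) = {e}" using cuts(1) M(1) unfolding cut_sym_diff by auto
    then show False using no_bridge(1) by blast
  qed
  have tight_insert: "tight D"
    if D: "cut D = insert g M" "g \<notin> M" "\<And>R. cut R \<noteq> {g}" for D g
    unfolding tight_def
  proof (intro conjI impI allI ballI)
    show "card (cut D) \<le> 2" using D finM \<open>card M \<le> 1\<close> by simp
    fix R f assume "card (cut D) = 2" "f \<in> cut D"
    then have M1: "card M = 1" using D finM by simp
    then obtain m where m: "M = {m}" by (auto simp: card_1_singleton_iff)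
    show "cut R \<noteq> {f}"
    proof
      assume R: "cut R = {f}"
      then have "f = m" using D \<open>f \<in> cut D\<close> m by auto
      then have "cut (sym_diff D R) = {g}" using R D(1,2) m unfolding cut_sym_diff by auto
      then show False using D(3) by blast
    qed
  qed
  show ?thesis using tight_insert[OF cuts(1) M(1) no_bridge(1)] tight_insert[OF cuts(2) M(2) no_bridge(2)]
    by blast
qed

lemma lobe_tight:
  assumes c: "c \<in> verts G" and z: "z \<in> verts G" "z \<notin> tec_class c"
  shows "tight (lobe c z)"
  unfolding tight_def
proof (intro conjI impI allI ballI)
  let ?K = "lobe c z" and ?C = "tec_class c"
  note K = lobe_props[OF z]
  show thin: "card (cut ?K) \<le> 2" by (rule lobe_thin[OF c z])
  fix R e1 assume two: "card (cut ?K) = 2" and e1: "e1 \<in> cut ?K"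
  show "cut R \<noteq> {e1}"
  proof
    assume R: "cut R = {e1}"
    obtain e2 where e2: "e2 \<in> cut ?K" "e2 \<noteq> e1"
      using two e1 unfolding card_2_iff by (metis insert_iff)
    obtain z1 c1 where 1: "e1 \<in> edges G" "ends G e1 = {z1, c1}" "z1 \<in> ?K" "c1 \<in> ?C" "z1 \<notin> ?C" "c1 \<notin> ?K"
      by (rule cut_lobeE[OF z e1])
    obtain z2 c2 where 2: "e2 \<in> edges G" "ends G e2 = {z2, c2}" "z2 \<in> ?K" "c2 \<in> ?C" "z2 \<notin> ?C" "c2 \<notin> ?K"
      by (rule cut_lobeE[OF z e2(1)])
    have "c1 \<in> R \<longleftrightarrow> c2 \<in> R" by (rule tec_class_thin[OF c _ 1(4) 2(4)]) (simp add: R)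
    moreover have "(z1 \<in> R) \<noteq> (c1 \<in> R)" using in_cut_iff[OF 1(1,2), of R] R by simp
    moreover have "(z2 \<in> R) = (c2 \<in> R)" using in_cut_iff[OF 2(1,2), of R] R e2(2) by simp
    ultimately have "R \<inter> ?K \<noteq> {}" "?K - R \<noteq> {}" using 1(3) 2(3) by blast+
    then obtain f where "f \<in> cut R" "ends G f \<subseteq> ?K" using K(4) unfolding connected_set_def by blast
    then show False using R 1(2,6) by simp
  qed
qed

lemma tight_tcdec:
  assumes trees: "\<And>c. c \<in> verts G \<Longrightarrow> ptree k {X. X \<subseteq> verts G \<and> card (X \<inter> tec_class c) \<le> k} (verts G)"
    and "tight B" "B \<subseteq> verts G"
  shows "tcdec k B"
  using assms(2,3)
proof (induction "card B" arbitrary: B rule: less_induct)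
  case less
  note B = \<open>tight B\<close> \<open>B \<subseteq> verts G\<close>
  have finB: "finite B" using B(2) finite_verts by (rule finite_subset)
  have thinB: "card (cut B) \<le> 2" using B(1) by (simp add: tight_def)
  show ?case
  proof (cases "B = {}")
    case True
    then show ?thesis using tcdec.intro[of "{}" k "{}"] by (simp add: disjoint_def)
  next
    case False
    show ?thesis
    proof (cases "\<exists>D. D \<subseteq> B \<and> D \<noteq> {} \<and> D \<noteq> B \<and> tight D \<and> tight (B - D)")
      case True
      then obtain D where D: "D \<subseteq> B" "D \<noteq> {}" "D \<noteq> B" "tight D" "tight (B - D)" by blast
      have "card D < card B" "card (B - D) < card B"
        using D finB by (auto intro!: psubset_card_mono)
      then have dec: "tcdec k D" "tcdec k (B - D)" using less.hyps D B(2) by blast+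
      have U: "\<Union>{D, B - D} = B" using D(1) by auto
      have "card (cut D) \<le> 2" "card (cut (B - D)) \<le> 2" using D(4,5) by (simp_all add: tight_def)
      then have none: "{Y \<in> insert ({} \<union> \<Union>{D, B - D}) {D, B - D}. card (cut Y) \<ge> 3} = {}"
        unfolding U using thinB by fastforce
      have "tcdec k ({} \<union> \<Union>{D, B - D})"
      proof (rule tcdec.intro)
        show "disjoint {D, B - D}" by (auto simp: disjoint_def)
        show "\<forall>Y\<in>{D, B - D}. tcdec k Y" using dec by simp
        show "card (\<Union>(cut ` {Y \<in> insert ({} \<union> \<Union>{D, B - D}) {D, B - D}. card (cut Y) \<ge> 3})) \<le> k"
          unfolding none by simp
      qed simp_all
      then show ?thesis using U by simp
    next
      case indec: False
      obtain b where b: "b \<in> B" "cut B \<noteq> {} \<longrightarrow> (\<exists>e\<in>cut B. b \<in> ends G e)"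
      proof (cases "cut B = {}")
        case True
        then show thesis using that \<open>B \<noteq> {}\<close> by blast
      next
        case False
        then obtain e where "e \<in> cut B" by blast
        then obtain x y where "ends G e = {x, y}" "x \<in> B" by (elim cutE)
        then show thesis using that[of x] \<open>e \<in> cut B\<close> by auto
      qed
      have bV: "b \<in> verts G" using b(1) B(2) by blast
      let ?C = "tec_class b"
      have CB: "?C \<subseteq> B"
        using tec_class_thin[OF bV thinB tec_class_self[OF bV]] b(1) by blast
      have inner: "y \<in> ?C" if f: "f \<in> edges G" "ends G f = {x, y}" "y \<in> B" "x \<notin> B" for f x y
      proof (rule ccontr)
        assume y: "y \<notin> ?C"
        have "f \<in> cut B" using in_cut_iff[OF f(1,2)] f by simp
        then obtain e where e: "e \<in> cut B" "b \<in> ends G e" using b(2) by blast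
        from e(1) obtain b0 a where "e \<in> edges G" "ends G e = {b0, a}" "b0 \<in> B" "a \<notin> B"
          by (elim cutE)
        then have ab: "e \<in> edges G" "ends G e = {a, b}" "b \<in> B" "a \<notin> B" using e(2) b(1) by auto
        obtain A where A: "card (cut A) \<le> 2" "y \<in> A" "A \<inter> ?C = {}"
          using not_tec_separated[OF bV _ y] f(3) B(2) by blast
        have bA: "b \<in> - A" using A(3) tec_class_self[OF bV] by blast
        have "tight (B \<inter> - A) \<and> tight (B - - A)"
          by (rule tight_split[OF B ab f]) (use A bA in \<open>simp_all add: cut_compl\<close>)
        moreover have "B - - A = B - (B \<inter> - A)" "B \<inter> - A \<noteq> {}" "B \<inter> - A \<noteq> B"
          using bA b(1) A(2) f(3) by auto
        ultimately show False using indec by (metis Int_lower1)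
      qed
      have side: "lobe b v \<subseteq> B \<or> lobe b v \<inter> B = {}" if v: "v \<in> verts G" "v \<notin> ?C" for v
      proof (rule ccontr)
        assume "\<not> ?thesis"
        then have "B \<inter> lobe b v \<noteq> {}" "lobe b v - B \<noteq> {}" by blast+
        then obtain f where f: "f \<in> cut B" "ends G f \<subseteq> lobe b v"
          using lobe_props(4)[OF v] unfolding connected_set_def by blast
        from f(1) obtain y x where "f \<in> edges G" "ends G f = {y, x}" "y \<in> B" "x \<notin> B" by (elim cutE)
        then have "y \<in> ?C" "y \<in> lobe b v" using inner[of f x y] f(2) by (auto simp: insert_commute)
        then show False using lobe_props(3)[OF v] by blast
      qed
      have lobe_B: "lobe b v \<subseteq> B" if "v \<in> B - ?C" "v \<in> verts G" for v
        using side[of v] lobe_props(1)[of v b] that by blast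
      have lobe_dec: "tcdec k (lobe b v)" if v: "v \<in> B - ?C" "v \<in> verts G" for v
      proof -
        have v': "v \<in> verts G" "v \<notin> ?C" using v by blast+
        have "b \<notin> lobe b v" using lobe_props(3)[OF v'] tec_class_self[OF bV] by blast
        then have "lobe b v \<subset> B" using lobe_B[OF v] b(1) by blast
        then show ?thesis
          using less.hyps[of "lobe b v"] psubset_card_mono[OF finB] lobe_tight[OF bV v'] lobe_props(2)[OF v']
          by blast
      qed
      define good where "good K x \<longleftrightarrow> x \<in> ?C \<and> (cut K = {} \<or> (\<exists>e\<in>cut K. x \<in> ends G e))" for K x
      have ex_good: "\<exists>x. good (lobe b v) x" if v: "v \<in> verts G" "v \<notin> ?C" for v
      proof (cases "cut (lobe b v) = {}")
        case True
        then show ?thesis using tec_class_self[OF bV] by (auto simp: good_def)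
      next
        case False
        then obtain e where e: "e \<in> cut (lobe b v)" by blast
        obtain x y where "e \<in> edges G" "ends G e = {x, y}" "x \<in> lobe b v" "y \<in> ?C" "x \<notin> ?C" "y \<notin> lobe b v"
          by (rule cut_lobeE[OF v e])
        then show ?thesis using e by (auto simp: good_def)
      qed
      have good_outer: "good (lobe b v) b" if v: "v \<in> verts G" "v \<notin> B" for v
      proof (rule ccontr)
        assume bad: "\<not> ?thesis"
        have v': "v \<in> verts G" "v \<notin> ?C" using v CB by blast+
        have vB: "lobe b v \<inter> B = {}" using side[OF v'] lobe_props(1)[OF v'] v by blast
        have sub: "cut (lobe b v) \<subseteq> cut B"
        proof
          fix f assume f: "f \<in> cut (lobe b v)"
          obtain x y where xy: "f \<in> edges G" "ends G f = {x, y}" "x \<in> lobe b v" "y \<in> ?C" "x \<notin> ?C"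
            "y \<notin> lobe b v" by (rule cut_lobeE[OF v' f])
          then show "f \<in> cut B" using in_cut_iff[OF xy(1,2)] vB CB by blast
        qed
        have ne: "cut (lobe b v) \<noteq> {}" "\<forall>e\<in>cut (lobe b v). b \<notin> ends G e"
          using bad tec_class_self[OF bV] by (auto simp: good_def)
        then obtain f where f: "f \<in> cut (lobe b v)" by blast
        obtain e where e: "e \<in> cut B" "b \<in> ends G e" using b(2) f sub by blast
        have "e \<notin> cut (lobe b v)" using ne e by blast
        then have "e \<noteq> f" using f by blast
        then have "card {e, f} = 2" "{e, f} \<subseteq> cut B" using e f sub by auto
        then have "cut B = {e, f}" using thinB card_seteq[of "cut B" "{e, f}"] by simp
        then have "cut (lobe b v) = {f}" "card (cut B) = 2" "f \<in> cut B"
          using sub f \<open>e \<notin> cut (lobe b v)\<close> \<open>card {e, f} = 2\<close> by auto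
        then show False using B(1) unfolding tight_def by blast
      qed
      define \<phi> where "\<phi> v = (if v \<in> ?C then v else if v \<in> B then SOME x. good (lobe b v) x else b)" for v
      have \<phi>_good: "good (lobe b v) (\<phi> v)" if v: "v \<in> verts G" "v \<notin> ?C" for v
        using someI_ex[OF ex_good[OF v]] good_outer[OF v(1)] v(2) by (cases "v \<in> B") (simp_all only: \<phi>_def if_True if_False not_False_eq_True)
      have \<phi>_lobe: "\<phi> w = \<phi> v" if v: "v \<in> verts G" "v \<notin> ?C" and w: "w \<in> lobe b v" for v w
      proof -
        have "w \<notin> ?C" "lobe b w = lobe b v" using lobe_props(3,5)[OF v] w by blast+
        moreover have "w \<in> B \<longleftrightarrow> v \<in> B" using side[OF v] lobe_props(1)[OF v] w by blast
        ultimately show ?thesis using v(2) by (simp only: \<phi>_def if_False)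
      qed
      have \<phi>: "retraction b \<phi>"
        unfolding retraction_def
      proof (intro conjI ballI)
        show "\<phi> v = v" if "v \<in> ?C" for v using that by (simp only: \<phi>_def if_True)
      next
        fix v assume "v \<in> verts G - ?C"
        then have v: "v \<in> verts G" "v \<notin> ?C" by blast+
        show "\<phi> v \<in> ?C" "cut (lobe b v) = {} \<or> (\<exists>e\<in>cut (lobe b v). \<phi> v \<in> ends G e)"
          using \<phi>_good[OF v] unfolding good_def by blast+
        show "\<phi> w = \<phi> v" if "w \<in> lobe b v" for w by (rule \<phi>_lobe[OF v that])
      qed
      let ?S = "{X. X \<subseteq> verts G \<and> card (X \<inter> ?C) \<le> k}"
      have "ptree k ?S (verts G - verts G)" by (auto intro: ptree.leaf)
      then obtain L where L: "L \<in> ?S" "b \<in> L" "ptree k ?S (verts G - L)"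
        using ptree_leaf_through[OF trees[OF bV] _ bV] by blast
      let ?D = "pull \<phi> (verts G - L)"
      let ?P = "insert ?D (lobe b ` (B - ?D - ?C))"
      have DB: "?D \<subseteq> B"
      proof
        fix v assume v: "v \<in> ?D"
        show "v \<in> B"
        proof (rule ccontr)
          assume "v \<notin> B"
          moreover from this have "v \<notin> ?C" using CB by blast
          ultimately have "\<phi> v = b" by (simp only: \<phi>_def if_False)
          then show False using v L(2) by (simp add: pull_def)
        qed
      qed
      have decD: "tcdec k ?D" using ptree_imp_tcdec[OF L(3) bV \<phi> _ DB] lobe_dec by blast
      have sub: "lobe b v \<subseteq> B - ?D - ?C" "v \<in> lobe b v" if v: "v \<in> B - ?D - ?C" for v
      proof -
        have v': "v \<in> verts G" "v \<notin> ?C" using v B(2) by blast+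
        have "w \<notin> ?D" if "w \<in> lobe b v" for w
          using \<phi>_lobe[OF v' that] v v'(1) by (simp add: pull_def)
        then show "lobe b v \<subseteq> B - ?D - ?C" "v \<in> lobe b v"
          using lobe_B[of v] v v' lobe_props(1,3)[OF v'] by blast+
      qed
      have UP: "\<Union>?P = ?D \<union> (B - ?D - ?C)" using sub by blast
      have LC: "L \<inter> ?C \<subseteq> B - ?D"
      proof
        fix v assume v: "v \<in> L \<inter> ?C"
        then have "\<phi> v = v" using \<phi> unfolding retraction_def by blast
        then show "v \<in> B - ?D" using v CB by (auto simp: pull_def)
      qed
      have CL: "B \<inter> ?C - ?D \<subseteq> L"
      proof
        fix v assume v: "v \<in> B \<inter> ?C - ?D"
        then have "\<phi> v = v" using \<phi> unfolding retraction_def by blast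
        then show "v \<in> L" using v B(2) by (auto simp: pull_def)
      qed
      have U: "L \<inter> ?C \<union> \<Union>?P = B" unfolding UP using LC CL DB by blast
      have "tcdec k (L \<inter> ?C \<union> \<Union>?P)"
      proof (rule tcdec.intro)
        show "card (L \<inter> ?C) \<le> k" using L(1) by simp
        show "L \<inter> ?C \<inter> \<Union>?P = {}" unfolding UP using LC by blast
        have "lobe b u \<inter> lobe b v = {}" if "lobe b u \<noteq> lobe b v" for u v
          using that comp_in_eq by (metis disjoint_iff)
        moreover have "?D \<inter> lobe b v = {}" if "v \<in> B - ?D - ?C" for v using sub(1)[OF that] by blast
        ultimately show "disjoint ?P" unfolding disjoint_def by (auto simp: Int_commute)
        have "tcdec k (lobe b v)" if "v \<in> B - ?D - ?C" for v
          using lobe_dec[of v] that B(2) by blast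
        then show "\<forall>Y\<in>?P. tcdec k Y" using decD by blast
        have "card (cut (lobe b v)) \<le> 2" if "v \<in> B - ?D - ?C" for v
          using lobe_thin[OF bV, of v] that B(2) by blast
        then have "{Y \<in> insert (L \<inter> ?C \<union> \<Union>?P) ?P. card (cut Y) \<ge> 3} \<subseteq> {?D}"
          unfolding U using thinB by fastforce
        moreover have "card (cut ?D) \<le> k"
          using retraction_border[OF bV \<phi>, of "{verts G - L}"] ptree_card_cut[OF L(3)] by simp
        ultimately show "card (\<Union>(cut ` {Y \<in> insert (L \<inter> ?C \<union> \<Union>?P) ?P. card (cut Y) \<ge> 3})) \<le> k"
          by (rule card_thick_border)
      qed auto
      then show ?thesis using U by simp
    qed
  qed
qed

lemma searchable_imp_tcdec:
  assumes "searchable G k k"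
  shows "tcdec k (verts G)"
  by (rule tight_tcdec[OF searchable_imp_ptree[OF assms]]) (simp_all add: tight_def)

end

subsection \<open>Trees of addresses\<close>

text \<open>A node is the list of the children chosen on the way from the root, the most recent one
  first, so that \<open>tl\<close> is the parent and \<open>suffix\<close> the ancestor relation. The injection \<open>g\<close> turns
  nodes into natural numbers; a tree edge is named after its lower end.\<close>

definition address_tree :: "('a list \<Rightarrow> nat) \<Rightarrow> 'a list set \<Rightarrow> (nat, nat) multigraph" where
  "address_tree g N = \<lparr>verts = g ` N, edges = g ` (N - {[]}),
     ends = (\<lambda>i. {i, g (tl (inv_into N g i))})\<rparr>"

locale addresses =
  fixes g :: "'a list \<Rightarrow> nat" and N :: "'a list set"
  assumes inj: "inj_on g N" and fin_N: "finite N" and root: "[] \<in> N"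
    and parent: "\<And>l. l \<in> N \<Longrightarrow> tl l \<in> N"
begin

abbreviation "T \<equiv> address_tree g N"

lemma T_simps [simp]: "verts T = g ` N" "edges T = g ` (N - {[]})"
  by (simp_all add: address_tree_def)

lemma ends_T: "l \<in> N \<Longrightarrow> ends T (g l) = {g l, g (tl l)}"
  using inj by (simp add: address_tree_def)

lemma g_eq_iff: "l \<in> N \<Longrightarrow> l' \<in> N \<Longrightarrow> g l = g l' \<longleftrightarrow> l = l'"
  using inj by (auto dest: inj_onD)

lemma fin_T: "fin_multigraph T"
proof -
  have "card (ends T (g l)) = 2" "ends T (g l) \<subseteq> g ` N" if "l \<in> N" "l \<noteq> []" for l
  proof -
    have "tl l \<noteq> l" using that(2) by (cases l) auto
    then have "g l \<noteq> g (tl l)" using g_eq_iff that(1) parent by metis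
    then show "card (ends T (g l)) = 2" "ends T (g l) \<subseteq> g ` N"
      using that(1) parent ends_T by simp_all
  qed
  then show ?thesis using fin_N unfolding fin_multigraph_def by auto
qed

sublocale T: finite_multigraph T
  by unfold_locales (rule fin_T)

lemma reach_parent:
  assumes "l \<in> N" "l \<noteq> []" "g l \<notin> F"
  shows "reachable_avoiding T F (g l) (g (tl l))"
  by (rule T.reachable_edge[of "g l"]) (use assms ends_T in auto)

lemma reach_ancestor:
  "l \<in> N \<Longrightarrow> suffix b l \<Longrightarrow> reachable_avoiding T {g b} (g l) (g b)" if b: "b \<in> N"
proof (induction l)
  case Nil
  then show ?case using T.reachable_refl root by simp
next
  case (Cons x l)
  show ?case
  proof (cases "b = x # l")
    case True
    then show ?thesis using T.reachable_refl Cons.prems by simp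
  next
    case False
    then have "g (x # l) \<noteq> g b" using g_eq_iff Cons.prems b by simp
    moreover have "reachable_avoiding T {g b} (g l) (g b)"
      using Cons False parent[OF Cons.prems(1)] by (auto simp: suffix_Cons)
    ultimately show ?thesis
      using reach_parent[OF Cons.prems(1), of "{g b}"] T.reachable_trans by (metis list.distinct(1) list.sel(3) singletonD)
  qed
qed

lemma reach_root:
  "l \<in> N \<Longrightarrow> \<not> suffix b l \<Longrightarrow> reachable_avoiding T {g b} (g l) (g [])" if b: "b \<in> N"
proof (induction l)
  case Nil
  then show ?case using T.reachable_refl root by simp
next
  case (Cons x l)
  then have "g (x # l) \<noteq> g b" using g_eq_iff b by auto
  moreover have "reachable_avoiding T {g b} (g l) (g [])"
    using Cons parent[OF Cons.prems(1)] by (auto simp: suffix_Cons)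
  ultimately show ?case
    using reach_parent[OF Cons.prems(1), of "{g b}"] T.reachable_trans by (metis list.distinct(1) list.sel(3) singletonD)
qed

lemma cut_descendants:
  assumes b: "b \<in> N"
  shows "T.cut (g ` {l \<in> N. suffix b l}) \<subseteq> {g b}"
proof
  let ?D = "g ` {l \<in> N. suffix b l}"
  have D: "g l \<in> ?D \<longleftrightarrow> suffix b l" if "l \<in> N" for l using that g_eq_iff by auto
  fix e assume e: "e \<in> T.cut ?D"
  then obtain l where l: "l \<in> N" "l \<noteq> []" "e = g l" using T.cut_subset[of ?D] by auto
  have "(g l \<in> ?D) \<noteq> (g (tl l) \<in> ?D)"
    using T.in_cut_iff[of e "g l" "g (tl l)" ?D] l ends_T e by auto
  then have "suffix b l \<noteq> suffix b (tl l)" using D l(1) parent by simp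
  then have "l = b" using l(2) by (cases l) (auto simp: suffix_Cons)
  then show "e \<in> {g b}" using l by simp
qed

lemma tree_T: "tree T"
  unfolding tree_def
proof (intro conjI ballI notI)
  show "fin_multigraph T" by (rule fin_T)
  show "verts T = {} \<Longrightarrow> False" using root by auto
next
  have to_root: "reachable_avoiding T {} (g l) (g [])" if "l \<in> N" for l
    using that
  proof (induction l)
    case Nil
    then show ?case using T.reachable_refl by simp
  next
    case (Cons x l)
    then show ?case
      using reach_parent[OF Cons.prems, of "{}"] parent[OF Cons.prems] T.reachable_trans by fastforce
  qed
  fix s t assume "s \<in> verts T" "t \<in> verts T"
  then obtain l m where "l \<in> N" "m \<in> N" "s = g l" "t = g m" by auto
  then have "reachable_avoiding T {} s t"
    using T.reachable_trans[OF to_root T.reachable_sym[OF to_root]] by blast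
  then show "\<exists>p. path T s p t" unfolding reachable_avoiding_def by blast
next
  assume "\<exists>t p. cycle T t p"
  then obtain t p where cyc: "cycle T t p" by blast
  then obtain e w q where "p = (e, w) # q" by (cases p) (auto simp: cycle_def)
  with cyc have c: "e \<in> edges T" "ends T e = {t, w}" "walk T w q t" "e \<notin> walk_edges q"
    by (auto simp: cycle_def walk_edges_def simp del: T_simps)
  obtain b where b: "b \<in> N" "b \<noteq> []" "e = g b" using c(1) by auto
  let ?D = "g ` {l \<in> N. suffix b l}"
  have "\<not> suffix b (tl b)" using b(2) by (metis length_tl suffix_length_le diff_less length_greater_0_conv
        less_numeral_extra(1) not_le)
  then have "g b \<in> ?D" "g (tl b) \<notin> ?D" using b(1) parent g_eq_iff by auto
  moreover have "{t, w} = {g b, g (tl b)}" using c(2) ends_T[OF b(1)] b(3) by simp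
  ultimately have "(t \<in> ?D) \<noteq> (w \<in> ?D)" by (auto simp: doubleton_eq_iff)
  then have "walk_edges q \<inter> T.cut ?D \<noteq> {}"
    using T.walk_crosses_cut[OF c(3), of ?D] T.walk_crosses_cut[OF c(3), of "- ?D"]
    unfolding T.cut_compl by auto
  then show False using cut_descendants[OF b(1)] b(3) c(4) by blast
qed

end

context finite_multigraph
begin

definition branch :: "'a list set \<Rightarrow> ('a list \<Rightarrow> 'v set) \<Rightarrow> 'a list \<Rightarrow> 'v set" where
  "branch N X l = \<Union>(X ` {m \<in> N. suffix l m})"

definition address_decomposition ::
    "nat \<Rightarrow> 'a list set \<Rightarrow> ('a list \<Rightarrow> 'v set) \<Rightarrow> 'v set \<Rightarrow> bool" where
  "address_decomposition k N X A \<longleftrightarrow> finite N \<and> [] \<in> N \<and> (\<forall>l\<in>N. tl l \<in> N) \<and>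
     disjoint_family_on X N \<and> \<Union>(X ` N) = A \<and> (\<forall>l\<in>N. card (X l) \<le> k) \<and>
     (\<forall>l\<in>N. card (\<Union>(cut ` {Y. card (cut Y) \<ge> 3 \<and>
        (\<exists>m\<in>N. (m = l \<or> m \<noteq> [] \<and> tl m = l) \<and> Y = branch N X m)})) \<le> k)"

lemma tcdec_subset: "tcdec k A \<Longrightarrow> A \<subseteq> verts G"
  by (induction rule: tcdec.induct) auto

lemma tcdec_imp_addresses:
  "tcdec k A \<Longrightarrow> \<exists>(N :: 'v set list set) X. address_decomposition k N X A"
proof (induction rule: tcdec.induct)
  case (intro X0 P)
  let ?A = "X0 \<union> \<Union>P"
  have "\<forall>Y\<in>P. \<exists>NX. address_decomposition k (fst NX :: 'v set list set) (snd NX) Y"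
    using intro.IH by auto
  from bchoice[OF this] obtain f where
    f: "\<And>Y. Y \<in> P \<Longrightarrow> address_decomposition k (fst (f Y) :: 'v set list set) (snd (f Y)) Y" by blast
  define NY XY where "NY = (\<lambda>Y. fst (f Y))" and "XY = (\<lambda>Y. snd (f Y))"
  have f: "address_decomposition k (NY Y) (XY Y) Y" if "Y \<in> P" for Y
    using f[OF that] by (simp add: NY_def XY_def)
  note fD = f[unfolded address_decomposition_def]
  define N where "N = insert [] (\<Union>Y\<in>P. (\<lambda>l. l @ [Y]) ` NY Y)"
  define X where "X l = (if l = [] then X0 else XY (last l) (butlast l))" for l
  have snoc: "l @ [Y] \<in> N \<longleftrightarrow> Y \<in> P \<and> l \<in> NY Y" for l Y by (auto simp: N_def)
  have X_simps: "X [] = X0" "X (l @ [Y]) = XY Y l" for l Y by (simp_all add: X_def)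
  have PV: "P \<subseteq> Pow (verts G)" using intro.IH tcdec_subset by blast
  have UY: "\<Union>(XY Y ` NY Y) = Y" if "Y \<in> P" for Y using fD[OF that] by blast
  have UN: "\<Union>(X ` N) = ?A"
  proof -
    have "\<Union>(X ` N) = X0 \<union> (\<Union>Y\<in>P. \<Union>(XY Y ` NY Y))" by (auto simp: N_def X_simps)
    then show ?thesis using UY by simp
  qed
  have br_root: "branch N X [] = ?A" using UN by (simp add: branch_def)
  have br: "branch N X (l @ [Y]) = branch (NY Y) (XY Y) l" if "Y \<in> P" for l Y
  proof -
    have "{m \<in> N. suffix (l @ [Y]) m} = (\<lambda>m. m @ [Y]) ` {m \<in> NY Y. suffix l m}"
      using that by (auto simp: N_def)
    then show ?thesis by (simp add: branch_def image_image X_simps)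
  qed
  have br1: "branch N X [Y] = Y" if "Y \<in> P" for Y
    using br[OF that, of "[]"] UY[OF that] by (simp add: branch_def)
  have "address_decomposition k N X ?A"
    unfolding address_decomposition_def
  proof (intro conjI ballI)
    have "finite P" by (rule finite_subset[OF PV]) simp
    then show "finite N" using fD by (auto simp: N_def)
    show "[] \<in> N" by (simp add: N_def)
    show "\<Union>(X ` N) = ?A" by (rule UN)
    show "tl l \<in> N" if "l \<in> N" for l
    proof (cases l rule: rev_cases)
      case (snoc m Y)
      then have "Y \<in> P" "m \<in> NY Y" using that \<open>\<And>l Y. (l @ [Y] \<in> N) = (Y \<in> P \<and> l \<in> NY Y)\<close> by simp_all
      then have "tl m \<in> NY Y" using fD by blast
      then show ?thesis using snoc \<open>Y \<in> P\<close> by (cases m) (auto simp: N_def)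
    qed (use that in simp)
    show "card (X l) \<le> k" if "l \<in> N" for l
      using that intro.hyps(2) fD by (auto simp: N_def X_simps)
    show "disjoint_family_on X N"
      unfolding disjoint_family_on_def
    proof (intro ballI impI)
      have root_disj: "X0 \<inter> XY Y l = {}" if "Y \<in> P" "l \<in> NY Y" for Y l
      proof -
        have "XY Y l \<subseteq> Y" using UY[OF that(1)] that(2) by blast
        then show ?thesis using intro.hyps(3) that(1) by blast
      qed
      have inner: "XY Y l \<inter> XY Z m = {}" if "Y \<in> P" "l \<in> NY Y" "Z \<in> P" "m \<in> NY Z" "l @ [Y] \<noteq> m @ [Z]"
        for Y Z l m
      proof (cases "Y = Z")
        case True
        then have "l \<noteq> m" using that(5) by simp
        then show ?thesis using fD[OF that(1)] that(2,4) True unfolding disjoint_family_on_def by blast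
      next
        case False
        then have "Y \<inter> Z = {}" using intro.hyps(4) that(1,3) by (simp add: disjoint_def)
        moreover have "XY Y l \<subseteq> Y" "XY Z m \<subseteq> Z" using UY that(1-4) by blast+
        ultimately show ?thesis by blast
      qed
      fix l m assume lm: "l \<in> N" "m \<in> N" "l \<noteq> m"
      show "X l \<inter> X m = {}"
        using lm root_disj inner by (cases l rule: rev_cases; cases m rule: rev_cases)
          (auto simp: X_simps snoc Int_commute)
    qed
    show "card (\<Union>(cut ` {Y. card (cut Y) \<ge> 3 \<and>
        (\<exists>m\<in>N. (m = l \<or> m \<noteq> [] \<and> tl m = l) \<and> Y = branch N X m)})) \<le> k" (is "card (\<Union>(cut ` ?B)) \<le> k")
      if l: "l \<in> N" for l
    proof (cases l rule: rev_cases)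
      case Nil
      have "?B \<subseteq> {Y \<in> insert ?A P. card (cut Y) \<ge> 3}"
      proof
        fix Y assume "Y \<in> ?B"
        then obtain m where m: "m \<in> N" "m = [] \<or> m \<noteq> [] \<and> tl m = []" "Y = branch N X m" "card (cut Y) \<ge> 3"
          using Nil by blast
        then have "Y \<in> insert ?A P"
          using br_root br1 snoc[of "[]"] by (cases m) auto
        then show "Y \<in> {Y \<in> insert ?A P. card (cut Y) \<ge> 3}" using m(4) by simp
      qed
      then have "card (\<Union>(cut ` ?B)) \<le> card (\<Union>(cut ` {Y \<in> insert ?A P. card (cut Y) \<ge> 3}))"
        by (rule card_mono[OF finite_border Union_mono[OF image_mono]])
      then show ?thesis using intro.hyps(5) by simp
    next
      case l': (snoc l0 Z)
      have Z: "Z \<in> P" "l0 \<in> NY Z" using l l' snoc by simp_all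
      let ?B' = "{Y. card (cut Y) \<ge> 3 \<and>
        (\<exists>m\<in>NY Z. (m = l0 \<or> m \<noteq> [] \<and> tl m = l0) \<and> Y = branch (NY Z) (XY Z) m)}"
      have "?B \<subseteq> ?B'"
      proof
        fix Y assume "Y \<in> ?B"
        then obtain m where m: "m \<in> N" "m = l0 @ [Z] \<or> m \<noteq> [] \<and> tl m = l0 @ [Z]"
          "Y = branch N X m" "card (cut Y) \<ge> 3" using l' by blast
        then obtain m0 W where m0: "m = m0 @ [W]" by (cases m rule: rev_cases) auto
        then have W: "W = Z" "m0 = l0 \<or> m0 \<noteq> [] \<and> tl m0 = l0" using m(2) by (cases m0; auto)+
        have "m0 \<in> NY Z" using m(1) m0 W(1) snoc by simp
        then show "Y \<in> ?B'" using m(3,4) m0 W br[OF Z(1), of m0] by auto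
      qed
      then have "card (\<Union>(cut ` ?B)) \<le> card (\<Union>(cut ` ?B'))"
        by (rule card_mono[OF finite_border Union_mono[OF image_mono]])
      also have "\<dots> \<le> k" using fD[OF Z(1)] Z(2) by blast
      finally show ?thesis .
    qed
  qed
  then show ?case by blast
qed

lemma addresses_imp_decomposition:
  fixes N :: "'a list set"
  assumes "address_decomposition k N X (verts G)"
  shows "\<exists>(T :: (nat, nat) multigraph) X. tree_cut_decomposition G T X \<and>
    adhesion_width G T X \<le> k \<and> bag_width T X \<le> k"
proof -
  note D = assms[unfolded address_decomposition_def]
  obtain g :: "'a list \<Rightarrow> nat" where "inj_on g N"
    using D finite_imp_inj_to_nat_seg by metis
  then interpret A: addresses g N using D by unfold_locales auto
  define X' where "X' i = X (inv_into N g i)" for i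
  have X'[simp]: "X' (g l) = X l" if "l \<in> N" for l using that A.inj by (simp add: X'_def)
  have uniq: "l = m" if "l \<in> N" "m \<in> N" "v \<in> X l" "v \<in> X m" for l m v
    using D that unfolding disjoint_family_on_def by blast
  have "tree_cut_decomposition G A.T X'"
    unfolding tree_cut_decomposition_def near_partition_on_def
  proof (intro conjI)
    show "tree A.T" by (rule A.tree_T)
    show "disjoint_family_on X' (verts A.T)"
      using uniq A.g_eq_iff by (fastforce simp: disjoint_family_on_def)
    show "\<Union>(X' ` verts A.T) = verts G" using D by (simp add: image_image)
  qed
  moreover have adh: "edge_adh G A.T X' (g b) \<subseteq> cut (branch N X b)" if b: "b \<in> N" for b
  proof
    fix e assume "e \<in> edge_adh G A.T X' (g b)"
    then obtain u v l m where e: "e \<in> edges G" "ends G e = {u, v}" "l \<in> N" "m \<in> N" "u \<in> X l" "v \<in> X m"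
      "\<not> reachable_avoiding A.T {g b} (g l) (g m)"
      unfolding edge_adh_def by auto
    have "suffix b l \<noteq> suffix b m"
    proof
      assume "suffix b l = suffix b m"
      then show False using e(7) A.T.reachable_trans[OF _ A.T.reachable_sym]
        A.reach_ancestor[OF b e(3)] A.reach_ancestor[OF b e(4)] A.reach_root[OF b e(3)] A.reach_root[OF b e(4)] by metis
    qed
    moreover have "u \<in> branch N X b \<longleftrightarrow> suffix b l" "v \<in> branch N X b \<longleftrightarrow> suffix b m"
      using e(3-6) uniq by (auto simp: branch_def)
    ultimately show "e \<in> cut (branch N X b)"
      using in_cut_iff[OF e(1,2)] by simp
  qed
  have node: "card (node_adh G A.T X' (g l)) \<le> k" if l: "l \<in> N" for l
  proof -
    let ?B = "{Y. card (cut Y) \<ge> 3 \<and>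
        (\<exists>m\<in>N. (m = l \<or> m \<noteq> [] \<and> tl m = l) \<and> Y = branch N X m)}"
    have "node_adh G A.T X' (g l) \<subseteq> \<Union>(cut ` ?B)"
    proof
      fix e assume "e \<in> node_adh G A.T X' (g l)"
      then obtain f where f: "f \<in> edges A.T" "g l \<in> ends A.T f" "bold G A.T X' f" "e \<in> edge_adh G A.T X' f"
        unfolding node_adh_def by blast
      then obtain m where m: "m \<in> N" "m \<noteq> []" "f = g m" by auto
      have "g l = g m \<or> g l = g (tl m)" using f(2) A.ends_T[OF m(1)] m(3) by simp
      then have "m = l \<or> m \<noteq> [] \<and> tl m = l" using A.g_eq_iff[OF l] m A.parent by auto
      moreover have "card (cut (branch N X m)) \<ge> 3"
        using f(3) card_mono[OF finite_cut adh[OF m(1)]] m(3) unfolding bold_def by simp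
      ultimately have "branch N X m \<in> ?B" using m(1) by blast
      then show "e \<in> \<Union>(cut ` ?B)" using f(4) adh[OF m(1)] m(3) by blast
    qed
    then have "card (node_adh G A.T X' (g l)) \<le> card (\<Union>(cut ` ?B))" by (rule card_mono[OF finite_border])
    also have "\<dots> \<le> k" using D l by blast
    finally show ?thesis .
  qed
  have "N \<noteq> {}" "finite N" using D by blast+
  then have "adhesion_width G A.T X' \<le> k" unfolding adhesion_width_def using node by simp
  moreover have "bag_width A.T X' \<le> k" unfolding bag_width_def using D \<open>N \<noteq> {}\<close> by simp
  ultimately show ?thesis using \<open>tree_cut_decomposition G A.T X'\<close> by blast
qed

lemma decomposition_exists:
  "\<exists>k (T :: (nat, nat) multigraph) X. tree_cut_decomposition G T X \<and>
    adhesion_width G T X \<le> k \<and> bag_width T X \<le> k"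
proof -
  let ?X = "\<lambda>_ :: 'v list. verts G"
  have "address_decomposition (card (verts G)) {[]} ?X (verts G)"
    unfolding address_decomposition_def
  proof (intro conjI ballI)
    fix l :: "'v list" assume l: "l \<in> {[]}"
    have "branch {[]} ?X [] = verts G" by (auto simp: branch_def)
    then have none: "{Y. card (cut Y) \<ge> 3 \<and>
      (\<exists>m\<in>{[]}. (m = l \<or> m \<noteq> [] \<and> tl m = l) \<and> Y = branch {[]} ?X m)} = {}" using l by auto
    show "card (\<Union>(cut ` {Y. card (cut Y) \<ge> 3 \<and>
      (\<exists>m\<in>{[]}. (m = l \<or> m \<noteq> [] \<and> tl m = l) \<and> Y = branch {[]} ?X m)})) \<le> card (verts G)"
      unfolding none by simp
  qed (simp_all add: disjoint_family_on_def)
  then show ?thesis using addresses_imp_decomposition by blast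
qed


subsection \<open>Searching along a decomposition\<close>

lemma tree_edge_separates:
  assumes "tree T" "f \<in> edges T" "ends T f = {s, t}"
  shows "\<not> reachable_avoiding T {f} s t"
proof
  assume "reachable_avoiding T {f} s t"
  then obtain p where p: "path T s p t" "f \<notin> walk_edges p" unfolding reachable_avoiding_def by blast
  have "distinct (map snd ((f, s) # p))" using p(1) by (simp add: path_def)
  moreover have "distinct (map fst ((f, s) # p))"
    using path_distinct_edges[OF p(1)] p(2) by (simp add: walk_edges_def)
  ultimately have "cycle T t ((f, s) # p)"
    using p(1) assms(2,3) by (simp add: cycle_def path_def insert_commute)
  then show False using assms(1) unfolding tree_def by blast
qed

lemma tree_first_step:
  assumes "tree T" "t \<in> verts T" "s \<in> verts T" "s \<noteq> t"
  obtains f t' where "f \<in> edges T" "ends T f = {t, t'}" "reachable_avoiding T {f} t' s"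
proof -
  obtain p where p: "path T t p s" using assms unfolding tree_def by blast
  with assms(4) obtain f t' q where q: "p = (f, t') # q" by (cases p) (auto simp: path_def)
  with p have "path T t' q s" "walk T t' q s" "f \<in> edges T" "ends T f = {t, t'}" "t \<notin> set (t' # map snd q)"
    by (auto simp: path_def)
  moreover from this have "f \<notin> walk_edges q" using walk_edges_ends[of T t' q s f] by auto
  ultimately show thesis using that unfolding reachable_avoiding_def by blast
qed

lemma decomposition_imp_searchable:
  fixes T :: "('t, 'f) multigraph"
  assumes "tree_cut_decomposition G T X" "adhesion_width G T X \<le> k" "bag_width T X \<le> k"
  shows "searchable G k k"
proof -
  have tree: "tree T" and part: "near_partition_on (verts G) (verts T) X"
    using assms(1) by (auto simp: tree_cut_decomposition_def)
  interpret T: finite_multigraph T using tree by unfold_locales (simp add: tree_def)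
  let ?R = "\<lambda>f. reachable_avoiding T {f}"
  have card_adh: "card (node_adh G T X t) \<le> k" if "t \<in> verts T" for t
  proof -
    have "card (node_adh G T X t) \<le> adhesion_width G T X"
      unfolding adhesion_width_def using that by (intro Max_ge) auto
    then show ?thesis using assms(2) by linarith
  qed
  have card_bag: "card (X t) \<le> k" if "t \<in> verts T" for t
  proof -
    have "card (X t) \<le> bag_width T X" unfolding bag_width_def using that by (intro Max_ge) auto
    then show ?thesis using assms(3) by linarith
  qed
  have XV: "X t \<subseteq> verts G" if "t \<in> verts T" for t
    using part that by (auto simp: near_partition_on_def)
  define \<nu> where "\<nu> v = (SOME t. t \<in> verts T \<and> v \<in> X t)" for v
  have \<nu>: "\<nu> v \<in> verts T" "v \<in> X (\<nu> v)" if "v \<in> verts G" for v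
  proof -
    have "\<exists>t. t \<in> verts T \<and> v \<in> X t" using part that by (auto simp: near_partition_on_def)
    from someI_ex[OF this] show "\<nu> v \<in> verts T" "v \<in> X (\<nu> v)" unfolding \<nu>_def by blast+
  qed
  define side where "side f t = {v \<in> verts G. ?R f t (\<nu> v)}" for f t
  have adh_sub: "edge_adh G T X f \<subseteq> edges G" for f by (auto simp: edge_adh_def)
  have fin_adh: "finite (edge_adh G T X f)" for f by (rule finite_subset[OF adh_sub]) simp
  have cut_side: "cut (side f t) \<subseteq> edge_adh G T X f" for f t
  proof
    fix e assume "e \<in> cut (side f t)"
    then obtain x y where e: "e \<in> edges G" "ends G e = {x, y}" "x \<in> side f t" "y \<notin> side f t"
      "x \<in> verts G" "y \<in> verts G" by (elim cutE)
    then have "\<not> ?R f (\<nu> x) (\<nu> y)" using T.reachable_trans[of "{f}" t "\<nu> x" "\<nu> y"] by (auto simp: side_def)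
    then show "e \<in> edge_adh G T X f"
      using e(1,2) \<nu>[OF e(5)] \<nu>[OF e(6)] unfolding edge_adh_def by blast
  qed
  have thin_side: "x \<in> side f t \<longleftrightarrow> y \<in> side f t"
    if "\<not> bold G T X f" "three_edge_connected G x y" "x \<in> verts G" "y \<in> verts G" for f t x y
  proof -
    have "card (cut (side f t)) \<le> 2"
      using card_mono[OF fin_adh cut_side[of f t]] that(1) by (simp add: bold_def)
    then show ?thesis using that(2) three_edge_connected_iff[OF that(3,4)] by blast
  qed
  have adh_node: "edge_adh G T X f \<subseteq> node_adh G T X t"
    if "f \<in> edges T" "t \<in> ends T f" "bold G T X f" for f t
    using that unfolding node_adh_def by blast
  have node_sub: "node_adh G T X t \<subseteq> edges G" for t using adh_sub by (auto simp: node_adh_def)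
  have caught: "caught G k (node_adh G T X t) v" if t: "t \<in> verts T" "v \<in> verts G" "\<nu> v = t" for t v
  proof -
    have "w \<in> X t" if w: "w \<in> verts G" "three_edge_connected G v w"
      "reachable_avoiding G (node_adh G T X t) v w" for w
    proof (rule ccontr)
      assume "w \<notin> X t"
      then have "\<nu> w \<noteq> t" using \<nu>(2)[OF w(1)] by auto
      then obtain f t' where f: "f \<in> edges T" "ends T f = {t, t'}" "?R f t' (\<nu> w)"
        using tree_first_step[OF tree t(1) \<nu>(1)[OF w(1)]] by blast
      have "\<not> ?R f t (\<nu> w)"
        using tree_edge_separates[OF tree f(1,2)] T.reachable_trans[OF _ T.reachable_sym[OF f(3)]] by blast
      then have sep: "v \<in> side f t" "w \<notin> side f t"
        using t T.reachable_refl[OF t(1)] by (auto simp: side_def)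
      show False
      proof (cases "bold G T X f")
        case True
        have "cut (side f t) \<subseteq> node_adh G T X t" using cut_side adh_node[OF f(1) _ True] f(2) by blast
        then show False using reachable_closed[OF w(3) sep(1)] sep(2) by blast
      next
        case False
        then show False using thin_side[OF False w(2) t(2) w(1)] sep by blast
      qed
    qed
    then have "{w \<in> verts G. three_edge_connected G v w \<and> reachable_avoiding G (node_adh G T X t) v w} \<subseteq> X t"
      by blast
    then have "card {w \<in> verts G. three_edge_connected G v w \<and>
        reachable_avoiding G (node_adh G T X t) v w} \<le> card (X t)"
      by (rule card_mono[rotated]) (rule finite_subset[OF XV[OF t(1)] finite_verts])
    then show ?thesis using card_bag[OF t(1)] unfolding caught_def by linarith
  qed
  define nxt where "nxt t v = (if \<nu> v = t then t else
    SOME t'. \<exists>f\<in>edges T. ends T f = {t, t'} \<and> ?R f t' (\<nu> v))" for t v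
  have nxt: "\<exists>f\<in>edges T. ends T f = {t, nxt t v} \<and> ?R f (nxt t v) (\<nu> v)"
    if "t \<in> verts T" "v \<in> verts G" "\<nu> v \<noteq> t" for t v
  proof -
    have "\<exists>t'. \<exists>f\<in>edges T. ends T f = {t, t'} \<and> ?R f t' (\<nu> v)"
      using tree_first_step[OF tree that(1) \<nu>(1)[OF that(2)] that(3)] by blast
    from someI_ex[OF this] show ?thesis using that(3) by (simp only: nxt_def if_False)
  qed
  define \<sigma> where "\<sigma> h = (let t = foldl nxt (\<nu> (hd h)) (tl h)
    in if t \<in> verts T then node_adh G T X t else {})" for h
  have "cop_strategy G k \<sigma>"
    using card_adh node_sub by (auto simp: cop_strategy_def \<sigma>_def Let_def)
  moreover have "\<exists>i\<ge>1. caught G k (cops_at \<sigma> r i) (r i)" if play: "robber_play G \<sigma> r" for r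
  proof (rule ccontr)
    assume free: "\<not> ?thesis"
    have move: "robber_move G (cops_at \<sigma> r i) (cops_at \<sigma> r (Suc i)) (r i) (r (Suc i))" for i
      using play by (auto simp: robber_play_def dest!: spec[of _ "Suc i"])
    have rV: "r i \<in> verts G" for i
      using play move[of "i - 1"] by (cases i) (auto simp: robber_play_def robber_move_def reachable_avoiding_iff)
    have tec: "three_edge_connected G (r 0) (r i)" for i
    proof (induction i)
      case 0
      then show ?case by (simp add: three_edge_connected_def)
    next
      case (Suc i)
      moreover have "three_edge_connected G (r i) (r (Suc i))" using move[of i] by (simp add: robber_move_def)
      ultimately show ?case by (simp add: three_edge_connected_iff rV)
    qed
    define t where "t i = foldl nxt (\<nu> (r 0)) (map r [1..<Suc i])" for i
    have t0: "t 0 = \<nu> (r 0)" and tSuc: "t (Suc i) = nxt (t i) (r (Suc i))" for i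
      by (simp_all add: t_def)
    have hist: "map r [0..<Suc i] = r 0 # map r [1..<Suc i]" for i
      by (simp only: upt_conv_Cons[of 0] zero_less_Suc list.map One_nat_def)
    have cops: "cops_at \<sigma> r (Suc i) = node_adh G T X (t i)" if "t i \<in> verts T" for i
      using that unfolding cops_at_def \<sigma>_def hist t_def by (simp only: list.sel Let_def if_True nat.distinct if_False)
    have away: "\<nu> (r (Suc i)) \<noteq> t i" if "t i \<in> verts T" for i
      using free caught[OF that rV[of "Suc i"]] cops[OF that] by (metis le_add1 plus_1_eq_Suc)
    have tV: "t i \<in> verts T" for i
    proof (induction i)
      case 0
      then show ?case using \<nu>(1)[OF rV] t0 by simp
    next
      case (Suc i)
      obtain f where f: "f \<in> edges T" "ends T f = {t i, nxt (t i) (r (Suc i))}"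
        using nxt[OF Suc rV[of "Suc i"] away[OF Suc]] by blast
      then show ?case using T.ends_cases(3)[OF f] tSuc by simp
    qed
    have "\<forall>i. \<exists>f. f \<in> edges T \<and> ends T f = {t i, t (Suc i)} \<and> ?R f (t (Suc i)) (\<nu> (r (Suc i)))"
      using nxt[OF tV rV away[OF tV]] tSuc by metis
    from choice[OF this] obtain f where fE: "\<And>i. f i \<in> edges T" and ends: "\<And>i. ends T (f i) = {t i, t (Suc i)}"
      and ahead: "\<And>i. ?R (f i) (t (Suc i)) (\<nu> (r (Suc i)))" by blast
    have bridge: "\<not> ?R (f i) (t i) (t (Suc i))" for i by (rule tree_edge_separates[OF tree fE ends])
    have behind: "\<not> ?R (f i) (t i) (\<nu> (r (Suc i)))" for i
      using bridge T.reachable_trans[OF _ T.reachable_sym[OF ahead]] by blast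
    have bold: "bold G T X (f i)" for i
    proof (induction i rule: less_induct)
      case (less i)
      show ?case
      proof (rule ccontr)
        assume thin: "\<not> bold G T X (f i)"
        have "?R (f i) (t 0) (t j)" if "j \<le> i" for j
          using that
        proof (induction j)
          case 0
          then show ?case using T.reachable_refl[OF tV] by blast
        next
          case (Suc j)
          then have "f j \<noteq> f i" using less thin by (metis Suc_le_eq)
          then have "?R (f i) (t j) (t (Suc j))" by (intro T.reachable_edge[OF fE ends]) simp
          then show ?case using Suc T.reachable_trans Suc_leD by blast
        qed
        then have "r 0 \<in> side (f i) (t i)" using T.reachable_sym rV t0 by (auto simp: side_def)
        moreover have "r (Suc i) \<notin> side (f i) (t i)" using behind by (simp add: side_def)
        ultimately show False using thin_side[OF thin tec rV rV] by blast
      qed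
    qed
    have stay: "?R (f i) (t (Suc i)) (\<nu> (r (Suc (Suc i))))" for i
    proof -
      have "r (Suc i) \<in> side (f i) (t (Suc i))" using ahead rV by (simp add: side_def)
      moreover have "edge_adh G T X (f i) \<subseteq> cops_at \<sigma> r (Suc i) \<inter> cops_at \<sigma> r (Suc (Suc i))"
        unfolding cops[OF tV] using adh_node[OF fE _ bold] ends by simp
      then have "cut (side (f i) (t (Suc i))) \<subseteq> cops_at \<sigma> r (Suc i) \<inter> cops_at \<sigma> r (Suc (Suc i))"
        using cut_side by blast
      moreover have "reachable_avoiding G (cops_at \<sigma> r (Suc i) \<inter> cops_at \<sigma> r (Suc (Suc i)))
        (r (Suc i)) (r (Suc (Suc i)))" using move by (simp add: robber_move_def)
      ultimately have "r (Suc (Suc i)) \<in> side (f i) (t (Suc i))" using reachable_closed by blast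
      then show ?thesis by (simp add: side_def)
    qed
    define S where "S i = {s \<in> verts T. \<not> ?R (f i) (t i) s}" for i
    have "S (Suc i) \<subset> S i" for i
    proof
      have ne: "f (Suc i) \<noteq> f i" using stay[of i] behind[of "Suc i"] by metis
      show "S (Suc i) \<subseteq> S i"
      proof
        fix s assume s: "s \<in> S (Suc i)"
        show "s \<in> S i"
        proof (rule ccontr)
          assume "s \<notin> S i"
          then have R: "?R (f i) (t i) s" using s by (simp add: S_def)
          let ?A = "{x. ?R (f (Suc i)) (t (Suc i)) x}" and ?B = "{x. ?R (f i) (t i) x}"
          have A: "T.cut ?A \<subseteq> {f (Suc i)}" and B: "T.cut ?B \<subseteq> {f i}" by (rule T.cut_reachable_set)+
          have "t i \<in> ?A"
            using T.reachable_sym[OF T.reachable_edge[OF fE[of i] ends[of i], of "{f (Suc i)}"]] ne by simp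
          moreover have "t i \<in> ?B" using T.reachable_refl[OF tV] by simp
          moreover have "T.cut (?A \<inter> ?B) \<subseteq> {f i}"
          proof -
            have "t (Suc i) \<notin> ?B" using bridge by simp
            moreover have "f (Suc i) \<notin> T.cut ?B" using B ne by blast
            ultimately have "t (Suc (Suc i)) \<notin> ?B" using T.in_cut_iff[OF fE[of "Suc i"] ends[of "Suc i"], of ?B] by blast
            then have "f (Suc i) \<notin> T.cut (?A \<inter> ?B)"
              using T.in_cut_iff[OF fE[of "Suc i"] ends[of "Suc i"], of "?A \<inter> ?B"] \<open>t (Suc i) \<notin> ?B\<close> by blast
            moreover have "T.cut (?A \<inter> ?B) \<subseteq> T.cut ?A \<union> T.cut ?B" by (auto simp: T.cut_def)
            ultimately show ?thesis using A B by blast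
          qed
          ultimately have "s \<in> ?A \<inter> ?B" using T.reachable_closed[OF R, of "?A \<inter> ?B"] by blast
          then show False using s by (simp add: S_def)
        qed
      qed
      have "t (Suc i) \<in> S i" "t (Suc i) \<notin> S (Suc i)"
        using bridge tV T.reachable_refl by (simp_all add: S_def)
      then show "S (Suc i) \<noteq> S i" by blast
    qed
    moreover have "finite (S i)" for i by (simp add: S_def)
    ultimately have dec: "card (S (Suc i)) < card (S i)" for i by (simp add: psubset_card_mono)
    have "card (S i) + i \<le> card (S 0)" for i
    proof (induction i)
      case (Suc i)
      then show ?case using dec[of i] by linarith
    qed simp
    from this[of "Suc (card (S 0))"] show False by simp
  qed
  ultimately show ?thesis unfolding searchable_def by blast
qed

end

theorem corollary5p2:
  fixes G :: "('v, 'e) multigraph" and k :: nat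
  assumes "fin_multigraph G" and "verts G \<noteq> {}"
  shows "ab_tree_cut_width G \<le> k \<longleftrightarrow> k_searchable k G"
proof -
  interpret finite_multigraph G by unfold_locales (rule assms(1))
  let ?D = "\<lambda>j. \<exists>(T :: (nat, nat) multigraph) X. tree_cut_decomposition G T X \<and>
    adhesion_width G T X \<le> j \<and> bag_width T X \<le> j"
  show ?thesis
    unfolding k_searchable_def
  proof
    assume le: "ab_tree_cut_width G \<le> k"
    have "?D (ab_tree_cut_width G)"
      unfolding ab_tree_cut_width_def by (rule LeastI_ex[OF decomposition_exists])
    then obtain T :: "(nat, nat) multigraph" and X where "tree_cut_decomposition G T X"
      "adhesion_width G T X \<le> k" "bag_width T X \<le> k" using le order_trans by blast
    then show "searchable G k k" by (rule decomposition_imp_searchable)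
  next
    assume "searchable G k k"
    then obtain N :: "'v set list set" and X where "address_decomposition k N X (verts G)"
      using tcdec_imp_addresses[OF searchable_imp_tcdec] by blast
    then have "?D k" by (rule addresses_imp_decomposition)
    then show "ab_tree_cut_width G \<le> k" unfolding ab_tree_cut_width_def by (rule Least_le)
  qed
qed

end
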